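(* Let $X_0,X_1,\dots,X_n$ be real vector fields on a bounded domain $\Omega\subset\mathbb{R}^p$ satisfying (A1) and (A2) for some integer $r\ge 2$. Then the function $d:\Omega\times\Omega\to\mathbb{R}$ is a (finite) distance. Moreover, there exist a positive constant $c_1$ depending on $\Omega$ and the $X_i$'s and, for every $\Omega'\Subset\Omega$, a positive constant $c_2$ depending on $\Omega'$ and the $X_i$'s, such that $$c_1|x-y|\le d(x,y)\le c_2|x-y|^{1/r}\quad\text{for any }x,y\in\Omega'.$$ Hence, in particular, the distance $d$ induces the Euclidean topology.
   Context: A domain is a connected open set; $\Omega'\Subset\Omega$ means $\Omega'$ is a domain with $\overline{\Omega'}$ compact and contained in $\Omega$. Weights: $p_0=2$ and $p_i=1$ for $i=1,\dots,n$. For a multiindex $I=(i_1,\dots,i_k)$ with entries in $\{0,1,\dots,n\}$, the weight is $|I|=\sum_{j=1}^k p_{i_j}$, and $X_{[I]}=[X_{i_1},[X_{i_2},\dots[X_{i_{k-1}},X_{i_k}]\dots]]$ (with $X_{[I]}=X_{i_1}$ if $I=(i_1)$), where $[X,Y]=XY-YX$. $(X_{[I]})_x$ denotes the vector field $X_{[I]}$ evaluated at $x$. Assumptions, for an integer $r\ge2$: (A1) the coefficients of $X_1,\dots,X_n$ belong to $C^{r-1}(\overline\Omega)$ and the coefficients of $X_0$ belong to $C^{r-2}(\overline\Omega)$; (A2) the vectors $\{(X_{[I]})_x\}_{|I|\le r}$ span $\mathbb{R}^p$ at every $x\in\Omega$. Distance $d$: for $\delta>0$ let $C(\delta)$ be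 the class of absolutely continuous maps $\varphi:[0,1]\to\Omega$ with $\varphi'(t)=\sum_{|I|\le r}a_I(t)(X_{[I]})_{\varphi(t)}$ for a.e. $t$, where $a_I:[0,1]\to\mathbb{R}$ are measurable with $|a_I(t)|\le\delta^{|I|}$. Then $d(x,y)=\inf\{\delta>0:\exists\varphi\in C(\delta),\ \varphi(0)=x,\ \varphi(1)=y\}$. Dependence of constants (with $p,n,r,\Omega$ fixed): "depending on $\Omega'$ and the $X_i$'s" means depending on: (i) $\Omega'$; (ii) the $C^{r-1}(\overline\Omega)$ norms of the coefficients of $X_1,\dots,X_n$ and the $C^{r-2}(\overline\Omega)$ norms of those of $X_0$; (iii) the moduli of continuity on $\overline\Omega$ of the highest order derivatives of the coefficients of the $X_i$'s; (iv) a constant $c_0>0$ with $\inf_{x\in\Omega'}\max_{|I_1|,\dots,|I_p|\le r}|\det((X_{[I_1]})_x,\dots,(X_{[I_p]})_x)|\ge c_0$. *)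

theory Defs
  imports "HOL-Analysis.Analysis"
begin

section \<open>Domains\<close>

definition domain :: "(real^'p) set \<Rightarrow> bool" where
  "domain \<Omega> \<longleftrightarrow> open \<Omega> \<and> connected \<Omega>"

definition compactly_inside :: "(real^'p) set \<Rightarrow> (real^'p) set \<Rightarrow> bool" where
  "compactly_inside \<Omega>' \<Omega> \<longleftrightarrow> domain \<Omega>' \<and> compact (closure \<Omega>') \<and> closure \<Omega>' \<subseteq> \<Omega>"


section \<open>The spaces of functions with derivatives continuous up to the boundary\<close>

definition partial :: "'p::finite \<Rightarrow> (real^'p \<Rightarrow> real) \<Rightarrow> real^'p \<Rightarrow> real" where
  "partial k f x = frechet_derivative f (at x) (axis k 1)"

text \<open>A list of coordinate indices stands for the corresponding iterated partial derivative.\<close>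

fun partials :: "'p::finite list \<Rightarrow> (real^'p \<Rightarrow> real) \<Rightarrow> real^'p \<Rightarrow> real" where
  "partials [] f = f"
| "partials (k # ks) f = partial k (partials ks f)"

text \<open>Functions are only considered on the open set \<open>\<Omega>\<close>; their values outside \<open>\<Omega>\<close> are
  irrelevant, and on the boundary they are replaced by limits from inside \<open>\<Omega>\<close>.\<close>

definition bdry_ext :: "(real^'p) set \<Rightarrow> (real^'p \<Rightarrow> real) \<Rightarrow> real^'p \<Rightarrow> real" where
  "bdry_ext \<Omega> g x = (if x \<in> \<Omega> then g x else Lim (at x within \<Omega>) g)"

definition Ck_closure :: "nat \<Rightarrow> (real^'p::finite) set \<Rightarrow> (real^'p \<Rightarrow> real) \<Rightarrow> bool" where
  "Ck_closure k \<Omega> f \<longleftrightarrow>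
     (\<forall>ks. length ks < k \<longrightarrow> partials ks f differentiable_on \<Omega>) \<and>
     (\<forall>ks. length ks \<le> k \<longrightarrow> continuous_on (closure \<Omega>) (bdry_ext \<Omega> (partials ks f)))"

definition Ck_norm :: "nat \<Rightarrow> (real^'p::finite) set \<Rightarrow> (real^'p \<Rightarrow> real) \<Rightarrow> real" where
  "Ck_norm k \<Omega> f =
     (MAX ks\<in>{ks. length ks \<le> k}. SUP x\<in>closure \<Omega>. \<bar>bdry_ext \<Omega> (partials ks f) x\<bar>)"

definition modulus :: "(real^'p) set \<Rightarrow> (real^'p \<Rightarrow> real) \<Rightarrow> real \<Rightarrow> real" where
  "modulus \<Omega> g s =
     (SUP (x, y)\<in>{(x, y). x \<in> closure \<Omega> \<and> y \<in> closure \<Omega> \<and> dist x y \<le> s}.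
        \<bar>bdry_ext \<Omega> g x - bdry_ext \<Omega> g y\<bar>)"


section \<open>Vector fields and commutators\<close>

definition vf_apply :: "(real^'p \<Rightarrow> real^'p) \<Rightarrow> (real^'p::finite \<Rightarrow> real) \<Rightarrow> real^'p \<Rightarrow> real" where
  "vf_apply X f x = (\<Sum>k\<in>UNIV. (X x $ k) * partial k f x)"

text \<open>The first order operator \<open>XY - YX\<close> has as its \<open>k\<close>-th coefficient its value on the
  coordinate function \<open>x\<^sub>k\<close>, and \<open>Y x\<^sub>k\<close> is the \<open>k\<close>-th coefficient of \<open>Y\<close>.\<close>

definition commutator ::
  "(real^'p::finite \<Rightarrow> real^'p) \<Rightarrow> (real^'p \<Rightarrow> real^'p) \<Rightarrow> real^'p \<Rightarrow> real^'p" where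
  "commutator X Y x =
     (\<chi> k. vf_apply X (\<lambda>y. Y y $ k) x - vf_apply Y (\<lambda>y. X y $ k) x)"

text \<open>The value for the empty list is a dummy; multiindices are nonempty.\<close>

fun iter_commutator ::
  "(nat \<Rightarrow> real^'p::finite \<Rightarrow> real^'p) \<Rightarrow> nat list \<Rightarrow> real^'p \<Rightarrow> real^'p" where
  "iter_commutator X [] = (\<lambda>x. 0)"
| "iter_commutator X [i] = X i"
| "iter_commutator X (i # j # I) = commutator (X i) (iter_commutator X (j # I))"

definition wt :: "nat \<Rightarrow> nat" where
  "wt i = (if i = 0 then 2 else 1)"

definition weight :: "nat list \<Rightarrow> nat" where
  "weight I = sum_list (map wt I)"

definition multiindices :: "nat \<Rightarrow> nat \<Rightarrow> nat list set" where
  "multiindices n r = {I. I \<noteq> [] \<and> set I \<subseteq> {0..n} \<and> weight I \<le> r}"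

lemma length_le_weight: "length I \<le> weight I"
  by (induction I) (auto simp: weight_def wt_def)

lemma finite_multiindices: "finite (multiindices n r)"
proof (rule finite_subset)
  show "multiindices n r \<subseteq> {I. set I \<subseteq> {0..n} \<and> length I \<le> r}"
    using length_le_weight order_trans by (auto simp: multiindices_def)
  show "finite {I. set I \<subseteq> {0..n} \<and> length I \<le> r}"
    by (rule finite_lists_length_le) simp
qed


section \<open>The assumptions on the vector fields\<close>

text \<open>The exponent \<open>r - wt i\<close> is \<open>r - 1\<close> for \<open>i = 1, \<dots>, n\<close> and \<open>r - 2\<close> for \<open>i = 0\<close>.\<close>

definition assumption_A1 ::
  "(real^'p::finite) set \<Rightarrow> nat \<Rightarrow> nat \<Rightarrow> (nat \<Rightarrow> real^'p \<Rightarrow> real^'p) \<Rightarrow> bool" where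
  "assumption_A1 \<Omega> n r X \<longleftrightarrow>
     (\<forall>i\<le>n. \<forall>k. Ck_closure (r - wt i) \<Omega> (\<lambda>x. X i x $ k))"

definition assumption_A2 ::
  "(real^'p::finite) set \<Rightarrow> nat \<Rightarrow> nat \<Rightarrow> (nat \<Rightarrow> real^'p \<Rightarrow> real^'p) \<Rightarrow> bool" where
  "assumption_A2 \<Omega> n r X \<longleftrightarrow>
     (\<forall>x\<in>\<Omega>. span ((\<lambda>I. iter_commutator X I x) ` multiindices n r) = UNIV)"

definition norms_bounded_by ::
  "(real^'p::finite) set \<Rightarrow> nat \<Rightarrow> nat \<Rightarrow> (nat \<Rightarrow> real^'p \<Rightarrow> real^'p) \<Rightarrow> real \<Rightarrow> bool" where
  "norms_bounded_by \<Omega> n r X M \<longleftrightarrow>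
     (\<forall>i\<le>n. \<forall>k. Ck_norm (r - wt i) \<Omega> (\<lambda>x. X i x $ k) \<le> M)"

definition moduli_bounded_by ::
  "(real^'p::finite) set \<Rightarrow> nat \<Rightarrow> nat \<Rightarrow> (nat \<Rightarrow> real^'p \<Rightarrow> real^'p) \<Rightarrow> (real \<Rightarrow> real) \<Rightarrow> bool" where
  "moduli_bounded_by \<Omega> n r X \<omega> \<longleftrightarrow>
     (\<forall>i\<le>n. \<forall>k. \<forall>ks. length ks = r - wt i \<longrightarrow>
        (\<forall>s>0. modulus \<Omega> (partials ks (\<lambda>x. X i x $ k)) s \<le> \<omega> s))"

definition max_det ::
  "nat \<Rightarrow> nat \<Rightarrow> (nat \<Rightarrow> real^'p::finite \<Rightarrow> real^'p) \<Rightarrow> real^'p \<Rightarrow> real" where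
  "max_det n r X x =
     (MAX J\<in>{J :: 'p \<Rightarrow> nat list. range J \<subseteq> multiindices n r}.
        \<bar>det (\<chi> k. iter_commutator X (J k) x)\<bar>)"


section \<open>The control distance\<close>

definition abs_continuous_on_interval :: "real \<Rightarrow> real \<Rightarrow> (real \<Rightarrow> real^'p) \<Rightarrow> bool" where
  "abs_continuous_on_interval a b \<phi> \<longleftrightarrow>
     (\<forall>\<epsilon>>0. \<exists>\<eta>>0. \<forall>D :: (real \<times> real) set.
        finite D \<and> (\<forall>(s, t)\<in>D. a \<le> s \<and> s \<le> t \<and> t \<le> b) \<and>
        disjoint_family_on (\<lambda>(s, t). {s<..<t}) D \<and> (\<Sum>(s, t)\<in>D. t - s) < \<eta>
        \<longrightarrow> (\<Sum>(s, t)\<in>D. norm (\<phi> t - \<phi> s)) < \<epsilon>)"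

definition admissible_curves ::
  "(real^'p::finite) set \<Rightarrow> nat \<Rightarrow> nat \<Rightarrow> (nat \<Rightarrow> real^'p \<Rightarrow> real^'p) \<Rightarrow> real \<Rightarrow> (real \<Rightarrow> real^'p) set"
  where
  "admissible_curves \<Omega> n r X \<delta> =
     {\<phi>. \<phi> ` {0..1} \<subseteq> \<Omega> \<and> abs_continuous_on_interval 0 1 \<phi> \<and>
         (\<exists>a :: nat list \<Rightarrow> real \<Rightarrow> real.
            (\<forall>I\<in>multiindices n r. a I \<in> borel_measurable (lebesgue_on {0..1}) \<and>
               (\<forall>t\<in>{0..1}. \<bar>a I t\<bar> \<le> \<delta> ^ weight I)) \<and>
            (AE t in lebesgue_on {0..1}.
               (\<phi> has_vector_derivative
                  (\<Sum>I\<in>multiindices n r. a I t *\<^sub>R iter_commutator X I (\<phi> t)))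
                 (at t within {0..1})))}"

text \<open>Extended-real-valued, so that the infimum is \<open>\<infinity>\<close> when no curve joins the two points.\<close>

definition control_edist ::
  "(real^'p::finite) set \<Rightarrow> nat \<Rightarrow> nat \<Rightarrow> (nat \<Rightarrow> real^'p \<Rightarrow> real^'p) \<Rightarrow> real^'p \<Rightarrow> real^'p \<Rightarrow> ereal"
  where
  "control_edist \<Omega> n r X x y =
     Inf {ereal \<delta> | \<delta>. \<delta> > 0 \<and> (\<exists>\<phi>\<in>admissible_curves \<Omega> n r X \<delta>. \<phi> 0 = x \<and> \<phi> 1 = y)}"

text \<open>The real-valued version takes the junk value 0 where \<^const>\<open>control_edist\<close> is infinite.\<close>

definition control_dist ::
  "(real^'p::finite) set \<Rightarrow> nat \<Rightarrow> nat \<Rightarrow> (nat \<Rightarrow> real^'p \<Rightarrow> real^'p) \<Rightarrow> real^'p \<Rightarrow> real^'p \<Rightarrow> real"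
  where
  "control_dist \<Omega> n r X x y = real_of_ereal (control_edist \<Omega> n r X x y)"

end

theory Submission
  imports Defs
begin

text \<open>The class of admissible curves allows every commutator of weight at most \<open>r\<close> as a direction, so
  near a point a straight segment from \<open>x\<close> to \<open>y\<close> is itself admissible: its velocity \<open>y - x\<close> is a
  combination of commutators with coefficients \<open>O(\<bar>x - y\<bar>)\<close>, and \<open>\<delta> ^ r \<le> \<delta> ^ weight I\<close> for
  \<open>\<delta> \<le> 1\<close>; this gives \<open>d(x, y) \<le> C \<bar>x - y\<bar> powr (1/r)\<close> at small scales, and chaining gives it on
  \<open>\<Omega>'\<close>. Conversely, all weights are at least 1, so an admissible curve with small \<open>\<delta>\<close> has speed \<open>O(\<delta>)\<close>.
  Uniformity of the constants comes from treating a whole class of systems \<open>X\<close> as one index set: uniform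
  boundedness and equicontinuity of the coefficients and their derivatives pass to the commutators.
  A single system is the case of a one-element class.\<close>

section \<open>Uniformly controlled families of functions\<close>

text \<open>Brackets use up the regularity: each one costs a derivative and adds at least one unit
  of weight, so a commutator of weight |I| keeps r - |I| derivatives and at weight r only continuity
  is left. With no Lipschitz bound there, the largest minor is kept away from 0 along a segment by
  equicontinuity; this is how the moduli of continuity enter the constants.

  All constants must be fixed before the system is. The radius of the local estimate depends on the
  common bounds, the moduli and \<open>c0\<close>; the length of a chain depends only on \<Omega>'
  and that radius. Segments between nearby points of \<Omega>' may leave \<Omega>', so estimates
  only ask that they stay in \<Omega>.

  For the lower bound, a derivative bounded almost everywhere does not control increments by itself
  (Cantor's function); absolute continuity closes this gap.

  The distance stays extended-real until it is known to be finite: symmetry and the triangle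
  inequality come first, so finite distance is an equivalence relation; the local bound makes its
  classes open, and connectedness of \<Omega> leaves a single class.\<close>

text \<open>Equicontinuity is only required along segments inside \<open>\<Omega>\<close>: since \<open>\<Omega>\<close> has no boundary
  regularity, bounded derivatives give a Lipschitz bound along segments, but not with respect to
  the Euclidean distance on all of \<open>\<Omega>\<close>.\<close>

definition bdd_equicont ::
  "(real^'p::finite) set \<Rightarrow> 'i set \<Rightarrow> ('i \<Rightarrow> real^'p \<Rightarrow> real) \<Rightarrow> bool" where
  "bdd_equicont \<Omega> A f \<longleftrightarrow>
     (\<exists>B. \<forall>a\<in>A. \<forall>x\<in>\<Omega>. \<bar>f a x\<bar> \<le> B) \<and>
     (\<forall>\<epsilon>>0. \<exists>\<rho>>0. \<forall>a\<in>A. \<forall>x y. closed_segment x y \<subseteq> \<Omega> \<and> dist x y < \<rho> \<longrightarrow> \<bar>f a x - f a y\<bar> < \<epsilon>)"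

lemma bdd_equicontE:
  assumes "bdd_equicont \<Omega> A f"
  obtains B where "B > 0" "\<And>a x. a \<in> A \<Longrightarrow> x \<in> \<Omega> \<Longrightarrow> \<bar>f a x\<bar> \<le> B"
proof -
  obtain B where B: "\<forall>a\<in>A. \<forall>x\<in>\<Omega>. \<bar>f a x\<bar> \<le> B"
    using assms unfolding bdd_equicont_def by blast
  show ?thesis
    using B by (intro that[of "max B 1"]) fastforce+
qed

lemma bdd_equicontD:
  assumes "bdd_equicont \<Omega> A f" "\<epsilon> > 0"
  obtains \<rho> where "\<rho> > 0"
    "\<And>a x y. a \<in> A \<Longrightarrow> closed_segment x y \<subseteq> \<Omega> \<Longrightarrow> dist x y < \<rho> \<Longrightarrow> \<bar>f a x - f a y\<bar> < \<epsilon>"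
  using assms unfolding bdd_equicont_def by meson

lemma bdd_equicont_const: "bdd_equicont \<Omega> A (\<lambda>a x. c)"
  by (auto simp: bdd_equicont_def)

lemma bdd_equicont_cong:
  assumes "\<And>a x. a \<in> A \<Longrightarrow> x \<in> \<Omega> \<Longrightarrow> f a x = g a x"
  shows "bdd_equicont \<Omega> A f \<longleftrightarrow> bdd_equicont \<Omega> A g"
proof -
  have *: "(closed_segment x y \<subseteq> \<Omega> \<and> dist x y < \<rho> \<longrightarrow> \<bar>f a x - f a y\<bar> < \<epsilon>) \<longleftrightarrow>
      (closed_segment x y \<subseteq> \<Omega> \<and> dist x y < \<rho> \<longrightarrow> \<bar>g a x - g a y\<bar> < \<epsilon>)"
    if "a \<in> A" for a x y \<rho> \<epsilon>
  proof -
    have "x \<in> closed_segment x y" "y \<in> closed_segment x y"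
      by auto
    then show ?thesis
      using assms that by (metis subsetD)
  qed
  show ?thesis
    unfolding bdd_equicont_def by (simp add: assms * cong: ball_cong)
qed

lemma bdd_equicont_add:
  assumes f: "bdd_equicont \<Omega> A f" and g: "bdd_equicont \<Omega> A g"
  shows "bdd_equicont \<Omega> A (\<lambda>a x. f a x + g a x)"
  unfolding bdd_equicont_def
proof (intro conjI allI impI)
  obtain B where B: "\<And>a x. a \<in> A \<Longrightarrow> x \<in> \<Omega> \<Longrightarrow> \<bar>f a x\<bar> \<le> B" using bdd_equicontE[OF f] by metis
  obtain C where C: "\<And>a x. a \<in> A \<Longrightarrow> x \<in> \<Omega> \<Longrightarrow> \<bar>g a x\<bar> \<le> C" using bdd_equicontE[OF g] by metis
  show "\<exists>B. \<forall>a\<in>A. \<forall>x\<in>\<Omega>. \<bar>f a x + g a x\<bar> \<le> B"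
    by (rule exI[of _ "B + C"]) (use B C in \<open>fastforce\<close>)
  fix \<epsilon> :: real assume e: "\<epsilon> > 0"
  obtain \<rho> where \<rho>: "\<rho> > 0"
    "\<And>a x y. a \<in> A \<Longrightarrow> closed_segment x y \<subseteq> \<Omega> \<Longrightarrow> dist x y < \<rho> \<Longrightarrow> \<bar>f a x - f a y\<bar> < \<epsilon>/2"
    using bdd_equicontD[OF f, of "\<epsilon>/2"] e by auto
  obtain \<sigma> where \<sigma>: "\<sigma> > 0"
    "\<And>a x y. a \<in> A \<Longrightarrow> closed_segment x y \<subseteq> \<Omega> \<Longrightarrow> dist x y < \<sigma> \<Longrightarrow> \<bar>g a x - g a y\<bar> < \<epsilon>/2"
    using bdd_equicontD[OF g, of "\<epsilon>/2"] e by auto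
  show "\<exists>\<rho>>0. \<forall>a\<in>A. \<forall>x y. closed_segment x y \<subseteq> \<Omega> \<and> dist x y < \<rho> \<longrightarrow>
      \<bar>f a x + g a x - (f a y + g a y)\<bar> < \<epsilon>"
  proof (intro exI[of _ "min \<rho> \<sigma>"] conjI ballI allI impI)
    fix a x y assume "a \<in> A" "closed_segment x y \<subseteq> \<Omega> \<and> dist x y < min \<rho> \<sigma>"
    then have "\<bar>f a x - f a y\<bar> < \<epsilon>/2" "\<bar>g a x - g a y\<bar> < \<epsilon>/2"
      using \<rho>(2)[of a x y] \<sigma>(2)[of a x y] by auto
    then show "\<bar>f a x + g a x - (f a y + g a y)\<bar> < \<epsilon>" by linarith
  qed (use \<rho> \<sigma> in auto)
qed

lemma bdd_equicont_mult:
  assumes f: "bdd_equicont \<Omega> A f" and g: "bdd_equicont \<Omega> A g"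
  shows "bdd_equicont \<Omega> A (\<lambda>a x. f a x * g a x)"
  unfolding bdd_equicont_def
proof (intro conjI allI impI)
  obtain B where B: "B > 0" "\<And>a x. a \<in> A \<Longrightarrow> x \<in> \<Omega> \<Longrightarrow> \<bar>f a x\<bar> \<le> B" using bdd_equicontE[OF f] by metis
  obtain C where C: "C > 0" "\<And>a x. a \<in> A \<Longrightarrow> x \<in> \<Omega> \<Longrightarrow> \<bar>g a x\<bar> \<le> C" using bdd_equicontE[OF g] by metis
  show "\<exists>B. \<forall>a\<in>A. \<forall>x\<in>\<Omega>. \<bar>f a x * g a x\<bar> \<le> B"
    by (rule exI[of _ "B * C"]) (use B C in \<open>auto simp: abs_mult intro!: mult_mono\<close>)
  fix \<epsilon> :: real assume e: "\<epsilon> > 0"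
  obtain \<rho> where \<rho>: "\<rho> > 0"
    "\<And>a x y. a \<in> A \<Longrightarrow> closed_segment x y \<subseteq> \<Omega> \<Longrightarrow> dist x y < \<rho> \<Longrightarrow> \<bar>f a x - f a y\<bar> < \<epsilon>/(2*C)"
    using bdd_equicontD[OF f, of "\<epsilon>/(2*C)"] e C by auto
  obtain \<sigma> where \<sigma>: "\<sigma> > 0"
    "\<And>a x y. a \<in> A \<Longrightarrow> closed_segment x y \<subseteq> \<Omega> \<Longrightarrow> dist x y < \<sigma> \<Longrightarrow> \<bar>g a x - g a y\<bar> < \<epsilon>/(2*B)"
    using bdd_equicontD[OF g, of "\<epsilon>/(2*B)"] e B by auto
  show "\<exists>\<rho>>0. \<forall>a\<in>A. \<forall>x y. closed_segment x y \<subseteq> \<Omega> \<and> dist x y < \<rho> \<longrightarrow>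
      \<bar>f a x * g a x - f a y * g a y\<bar> < \<epsilon>"
  proof (intro exI[of _ "min \<rho> \<sigma>"] conjI ballI allI impI)
    fix a x y assume a: "a \<in> A" and xy: "closed_segment x y \<subseteq> \<Omega> \<and> dist x y < min \<rho> \<sigma>"
    have "x \<in> \<Omega>" "y \<in> \<Omega>" using xy by (auto dest: subsetD)
    then have bd: "\<bar>f a x\<bar> \<le> B" "\<bar>g a y\<bar> \<le> C" using a B C by auto
    have small: "\<bar>f a x - f a y\<bar> < \<epsilon>/(2*C)" "\<bar>g a x - g a y\<bar> < \<epsilon>/(2*B)"
      using \<rho>(2)[of a x y] \<sigma>(2)[of a x y] a xy by auto
    have "f a x * g a x - f a y * g a y = f a x * (g a x - g a y) + (f a x - f a y) * g a y"
      by (simp add: algebra_simps)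
    then have "\<bar>f a x * g a x - f a y * g a y\<bar> \<le> \<bar>f a x\<bar> * \<bar>g a x - g a y\<bar> + \<bar>f a x - f a y\<bar> * \<bar>g a y\<bar>"
      by (metis abs_mult abs_triangle_ineq)
    also have "\<dots> \<le> B * \<bar>g a x - g a y\<bar> + \<bar>f a x - f a y\<bar> * C"
      using bd by (intro add_mono mult_mono) auto
    also have "\<dots> < B * (\<epsilon>/(2*B)) + \<epsilon>/(2*C) * C"
      using small B(1) C(1) by (intro add_strict_mono mult_strict_left_mono mult_strict_right_mono) auto
    also have "\<dots> = \<epsilon>" using B(1) C(1) by (simp add: field_simps)
    finally show "\<bar>f a x * g a x - f a y * g a y\<bar> < \<epsilon>" .
  qed (use \<rho> \<sigma> in auto)
qed

lemma bdd_equicont_sum: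
  assumes "\<And>s. s \<in> S \<Longrightarrow> bdd_equicont \<Omega> A (f s)"
  shows "bdd_equicont \<Omega> A (\<lambda>a x. \<Sum>s\<in>S. f s a x)"
  using assms
  by (induction S rule: infinite_finite_induct) (auto intro: bdd_equicont_const bdd_equicont_add)

lemma bdd_equicont_prod:
  assumes "\<And>s. s \<in> S \<Longrightarrow> bdd_equicont \<Omega> A (f s)"
  shows "bdd_equicont \<Omega> A (\<lambda>a x. \<Prod>s\<in>S. f s a x)"
  using assms
  by (induction S rule: infinite_finite_induct) (auto intro: bdd_equicont_const bdd_equicont_mult)

text \<open>The determinant is a polynomial in the entries. This carries equicontinuity from the
  commutators to the minors that measure the spanning condition.\<close>

lemma bdd_equicont_det:
  assumes "\<And>i j. bdd_equicont \<Omega> A (\<lambda>a x. F a x $ i $ j)"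
  shows "bdd_equicont \<Omega> A (\<lambda>a x. det (F a x :: real^'q^'q))"
  unfolding det_def
  by (intro bdd_equicont_sum bdd_equicont_mult bdd_equicont_const bdd_equicont_prod assms)

text \<open>Inside a ball around x contained in \<Omega> every segment ending at x stays in
  \<Omega>, so equicontinuity along segments gives ordinary continuity.\<close>

lemma bdd_equicont_singleton_imp_continuous_on:
  assumes "open \<Omega>" "bdd_equicont \<Omega> {a} f"
  shows "continuous_on \<Omega> (f a)"
  unfolding continuous_on_iff
proof (intro ballI allI impI)
  fix x :: "real^'a" and \<epsilon> :: real assume x: "x \<in> \<Omega>" and e: "\<epsilon> > 0"
  obtain \<rho> where \<rho>: "\<rho> > 0"
    "\<And>x y. closed_segment x y \<subseteq> \<Omega> \<Longrightarrow> dist x y < \<rho> \<Longrightarrow> \<bar>f a x - f a y\<bar> < \<epsilon>"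
    using bdd_equicontD[OF assms(2) e] by (metis insertI1)
  obtain s where s: "s > 0" "ball x s \<subseteq> \<Omega>" using assms(1) x open_contains_ball by blast
  show "\<exists>d>0. \<forall>x'\<in>\<Omega>. dist x' x < d \<longrightarrow> dist (f a x') (f a x) < \<epsilon>"
  proof (intro exI[of _ "min \<rho> s"] conjI ballI impI)
    fix y assume y: "dist y x < min \<rho> s"
    have "closed_segment y x \<subseteq> ball x s"
      by (rule closed_segment_subset) (use y s in \<open>auto simp: dist_commute\<close>)
    then show "dist (f a y) (f a x) < \<epsilon>"
      using \<rho>(2)[of y x] y s by (auto simp: dist_real_def)
  qed (use \<rho> s in auto)
qed

lemma bdd_equicont_subset:
  "bdd_equicont \<Omega> A f \<Longrightarrow> A' \<subseteq> A \<Longrightarrow> bdd_equicont \<Omega> A' f"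
  unfolding bdd_equicont_def by (meson subsetD)

section \<open>Uniform control of derivatives up to a given order\<close>

primrec smooth_family ::
  "(real^'p::finite) set \<Rightarrow> 'i set \<Rightarrow> nat \<Rightarrow> ('i \<Rightarrow> real^'p \<Rightarrow> real) \<Rightarrow> bool" where
  "smooth_family \<Omega> A 0 f \<longleftrightarrow> bdd_equicont \<Omega> A f"
| "smooth_family \<Omega> A (Suc m) f \<longleftrightarrow> bdd_equicont \<Omega> A f \<and> (\<forall>a\<in>A. f a differentiable_on \<Omega>) \<and>
     (\<forall>k. smooth_family \<Omega> A m (\<lambda>a. partial k (f a)))"

lemma smooth_family_imp_bdd_equicont: "smooth_family \<Omega> A m f \<Longrightarrow> bdd_equicont \<Omega> A f"
  by (cases m) auto

lemma smooth_family_mono: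
  assumes "m \<le> m'" "smooth_family \<Omega> A m' f"
  shows "smooth_family \<Omega> A m f"
  using assms
proof (induction m arbitrary: m' f)
  case 0
  then show ?case by (auto dest: smooth_family_imp_bdd_equicont)
next
  case (Suc m)
  then obtain l where l: "m' = Suc l" "m \<le> l" by (metis Suc_le_D Suc_le_mono)
  then show ?case using Suc by auto
qed

lemma partial_eqI: "(f has_derivative f') (at x) \<Longrightarrow> partial k f x = f' (axis k 1)"
  unfolding partial_def using frechet_derivative_at by metis

lemma has_derivative_frechet:
  "open \<Omega> \<Longrightarrow> f differentiable_on \<Omega> \<Longrightarrow> x \<in> \<Omega> \<Longrightarrow>
    (f has_derivative frechet_derivative f (at x)) (at x)"
  using differentiable_on_eq_differentiable_at frechet_derivative_works by blast

text \<open>Differentiability is not assumed: f and g have the same derivatives at x, if any, so the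
  choice operator inside \<open>frechet_derivative\<close> returns the same map for both.\<close>

lemma partial_cong:
  assumes "open \<Omega>" "x \<in> \<Omega>" "\<And>y. y \<in> \<Omega> \<Longrightarrow> f y = g y"
  shows "partial k f x = partial k g x"
proof -
  have "(f has_derivative D) (at x) \<longleftrightarrow> (g has_derivative D) (at x)" for D
    using assms has_derivative_transform_within_open[of _ D x UNIV \<Omega>] by metis
  then show ?thesis by (simp add: partial_def frechet_derivative_def)
qed

lemma partial_add:
  assumes "open \<Omega>" "x \<in> \<Omega>" "f differentiable_on \<Omega>" "g differentiable_on \<Omega>"
  shows "partial k (\<lambda>x. f x + g x) x = partial k f x + partial k g x"
  using has_derivative_add[OF has_derivative_frechet[OF assms(1,3,2)] has_derivative_frechet[OF assms(1,4,2)]]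
  by (subst partial_eqI) (auto simp: partial_def)

lemma partial_mult:
  assumes "open \<Omega>" "x \<in> \<Omega>" "f differentiable_on \<Omega>" "g differentiable_on \<Omega>"
  shows "partial k (\<lambda>x. f x * g x) x = f x * partial k g x + partial k f x * g x"
  using has_derivative_mult[OF has_derivative_frechet[OF assms(1,3,2)] has_derivative_frechet[OF assms(1,4,2)]]
  by (subst partial_eqI) (auto simp: partial_def)

lemma partial_const: "partial k (\<lambda>x. c) x = 0"
  by (subst partial_eqI[OF has_derivative_const]) simp

lemma smooth_family_cong:
  assumes "open \<Omega>" "\<And>a x. a \<in> A \<Longrightarrow> x \<in> \<Omega> \<Longrightarrow> f a x = g a x" "smooth_family \<Omega> A m f"
  shows "smooth_family \<Omega> A m g"
  using assms(2,3)
proof (induction m arbitrary: f g)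
  case 0
  then show ?case using bdd_equicont_cong[of A \<Omega> f g] by simp
next
  case (Suc m)
  have "g a differentiable_on \<Omega>" if "a \<in> A" for a
    unfolding differentiable_on_def
  proof
    fix x assume x: "x \<in> \<Omega>"
    have "f a differentiable at x within \<Omega>"
      using Suc.prems(2) that x by (auto simp: differentiable_on_def)
    then show "g a differentiable at x within \<Omega>"
      by (rule differentiable_transform_within[where d = 1]) (use Suc.prems(1) that x in auto)
  qed
  moreover have "smooth_family \<Omega> A m (\<lambda>a. partial k (g a))" for k
    by (rule Suc.IH[of "\<lambda>a. partial k (f a)"])
      (use Suc.prems in \<open>auto intro: partial_cong[OF assms(1)]\<close>)
  moreover have "bdd_equicont \<Omega> A g"
    using Suc.prems bdd_equicont_cong[of A \<Omega> f g] by simp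
  ultimately show ?case by simp
qed

lemma smooth_family_const: "smooth_family \<Omega> A m (\<lambda>a x. c)"
proof (induction m arbitrary: c)
  case (Suc m)
  then show ?case by (simp add: bdd_equicont_const partial_const[abs_def])
qed (simp add: bdd_equicont_const)

lemma smooth_family_add:
  assumes "open \<Omega>" "smooth_family \<Omega> A m f" "smooth_family \<Omega> A m g"
  shows "smooth_family \<Omega> A m (\<lambda>a x. f a x + g a x)"
  using assms(2,3)
proof (induction m arbitrary: f g)
  case 0
  then show ?case by (simp add: bdd_equicont_add)
next
  case (Suc m)
  have "smooth_family \<Omega> A m (\<lambda>a. partial k (\<lambda>x. f a x + g a x))" for k
    by (rule smooth_family_cong[OF assms(1) _ Suc.IH[of "\<lambda>a. partial k (f a)" "\<lambda>a. partial k (g a)"]])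
      (use Suc.prems partial_add[OF assms(1)] in auto)
  then show ?case using Suc.prems by (auto intro: bdd_equicont_add differentiable_on_add)
qed

lemma smooth_family_mult:
  assumes "open \<Omega>" "smooth_family \<Omega> A m f" "smooth_family \<Omega> A m g"
  shows "smooth_family \<Omega> A m (\<lambda>a x. f a x * g a x)"
  using assms(2,3)
proof (induction m arbitrary: f g)
  case 0
  then show ?case by (simp add: bdd_equicont_mult)
next
  case (Suc m)
  \<comment> \<open>The product rule pairs a derivative of one factor with the other factor itself,
    so the factors are needed at order m as well.\<close>
  have low: "smooth_family \<Omega> A m f" "smooth_family \<Omega> A m g"
    using Suc.prems smooth_family_mono[of m "Suc m"] by auto
  have "smooth_family \<Omega> A m (\<lambda>a. partial k (\<lambda>x. f a x * g a x))" for k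
  proof (rule smooth_family_cong[OF assms(1)])
    show "smooth_family \<Omega> A m (\<lambda>a x. f a x * partial k (g a) x + partial k (f a) x * g a x)"
      using Suc.prems by (intro smooth_family_add[OF assms(1)] Suc.IH low) auto
  qed (use Suc.prems partial_mult[OF assms(1)] in auto)
  then show ?case using Suc.prems by (auto intro: bdd_equicont_mult differentiable_on_mult)
qed

lemma smooth_family_sum:
  assumes "open \<Omega>" "\<And>s. s \<in> S \<Longrightarrow> smooth_family \<Omega> A m (f s)"
  shows "smooth_family \<Omega> A m (\<lambda>a x. \<Sum>s\<in>S. f s a x)"
  using assms(2)
  by (induction S rule: infinite_finite_induct)
    (auto intro: smooth_family_const smooth_family_add[OF assms(1)])

lemma smooth_family_diff:
  assumes "open \<Omega>" "smooth_family \<Omega> A m f" "smooth_family \<Omega> A m g"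
  shows "smooth_family \<Omega> A m (\<lambda>a x. f a x - g a x)"
proof -
  have "smooth_family \<Omega> A m (\<lambda>a x. f a x + (- 1) * g a x)"
    by (intro smooth_family_add smooth_family_mult smooth_family_const assms)
  then show ?thesis by simp
qed

text \<open>One more level of the recursion applies a derivative to those already taken, which is
  prefixing an index to the list. Hence the induction runs over the number l of derivatives still to
  come, with the list \<open>ks\<close> arbitrary.\<close>

lemma smooth_family_partials:
  assumes "\<And>ks. length ks \<le> m \<Longrightarrow> bdd_equicont \<Omega> A (\<lambda>a. partials ks (f a))"
    and "\<And>ks a. length ks < m \<Longrightarrow> a \<in> A \<Longrightarrow> partials ks (f a) differentiable_on \<Omega>"
  shows "smooth_family \<Omega> A m f"
proof -
  have "smooth_family \<Omega> A l (\<lambda>a. partials ks (f a))" if "length ks + l = m" for l ks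
    using that
  proof (induction l arbitrary: ks)
    case 0
    then show ?case using assms(1) by simp
  next
    case (Suc l)
    have "smooth_family \<Omega> A l (\<lambda>a. partial k (partials ks (f a)))" for k
      using Suc.IH[of "k # ks"] Suc.prems by simp
    then show ?case using Suc.prems assms by auto
  qed
  from this[of "[]" m] show ?thesis by simp
qed

section \<open>Regularity of iterated commutators\<close>

lemma commutator_smooth_family:
  assumes "open \<Omega>"
    and "\<And>k. smooth_family \<Omega> A (Suc m) (\<lambda>a x. X a x $ k)"
    and "\<And>k. smooth_family \<Omega> A (Suc m) (\<lambda>a x. Y a x $ k)"
  shows "smooth_family \<Omega> A m (\<lambda>a x. commutator (X a) (Y a) x $ k)"
proof -
  have low: "smooth_family \<Omega> A m (\<lambda>a x. X a x $ k)" "smooth_family \<Omega> A m (\<lambda>a x. Y a x $ k)" for k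
    using assms(2,3)[of k] smooth_family_mono[OF le_SucI[OF order_refl]] by blast+
  have "smooth_family \<Omega> A m (\<lambda>a. partial l (\<lambda>x. X a x $ k))"
    "smooth_family \<Omega> A m (\<lambda>a. partial l (\<lambda>x. Y a x $ k))" for k l
    using assms by auto
  then show ?thesis
    unfolding commutator_def vf_apply_def vec_lambda_beta
    by (intro smooth_family_sum smooth_family_mult smooth_family_diff low assms(1))
qed

lemma weight_Cons: "weight (i # I) = wt i + weight I"
  by (simp add: weight_def)

lemma weight_pos: "I \<noteq> [] \<Longrightarrow> weight I \<ge> 1"
  by (cases I) (auto simp: weight_Cons wt_def)

text \<open>Derivatives and weight are traded against each other: bracketing with \<open>X i\<close>
  loses one derivative and raises the weight by \<open>wt i\<close>, which is at least 1.\<close>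

lemma iter_commutator_smooth_family:
  assumes "open \<Omega>"
    and X: "\<And>i k. i \<le> n \<Longrightarrow> smooth_family \<Omega> A (r - wt i) (\<lambda>X x. X i x $ k)"
    and "I \<in> multiindices n r"
  shows "smooth_family \<Omega> A (r - weight I) (\<lambda>X x. iter_commutator X I x $ k)"
proof -
  have "I \<noteq> [] \<Longrightarrow> set I \<subseteq> {0..n} \<Longrightarrow> weight I \<le> r \<Longrightarrow>
      smooth_family \<Omega> A (r - weight I) (\<lambda>X x. iter_commutator X I x $ k)" for k
  proof (induction I arbitrary: k rule: induct_list012)
    case (2 i)
    then show ?case using X by (simp add: weight_def)
  next
    case (3 i j J)
    let ?m = "r - weight (i # j # J)"
    \<comment> \<open>The remaining list has weight at least 1, which leaves \<open>X i\<close> the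
      extra derivative; \<open>wt i\<close> is at least 1, which leaves it to the inner
      commutator.\<close>
    have w: "weight (i # j # J) = wt i + weight (j # J)" "weight (j # J) \<ge> 1" "wt i \<ge> 1"
      using weight_pos by (auto simp: weight_Cons[of i] wt_def)
    have "smooth_family \<Omega> A (Suc ?m) (\<lambda>X x. X i x $ k)" for k
      using 3 w by (intro smooth_family_mono[OF _ X]) auto
    moreover have "smooth_family \<Omega> A (Suc ?m) (\<lambda>X x. iter_commutator X (j # J) x $ k)" for k
      using 3 w by (intro smooth_family_mono[OF _ "3.IH"(2)]) auto
    ultimately show ?case
      using commutator_smooth_family[OF assms(1), of A ?m "\<lambda>X. X i" "\<lambda>X. iter_commutator X (j # J)"]
      by simp
  qed simp
  then show ?thesis using assms(3) by (auto simp: multiindices_def)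
qed

section \<open>Absolutely continuous curves with bounded derivative\<close>

text \<open>A tagged division is chosen fine enough that the intervals tagged in the exceptional null set
  have small total length, so absolute continuity controls their contribution; on the other
  intervals the derivative does.\<close>

lemma abs_continuous_imp_lipschitz:
  fixes \<phi> :: "real \<Rightarrow> real^'p::finite"
  assumes ac: "abs_continuous_on_interval a b \<phi>" and N: "negligible N"
    and deriv: "\<And>x. x \<in> {a..b} - N \<Longrightarrow> (\<phi> has_vector_derivative v x) (at x within {a..b})"
    and v: "\<And>x. x \<in> {a..b} - N \<Longrightarrow> norm (v x) \<le> L" and L: "L \<ge> 0"
  shows "L-lipschitz_on {a..b} \<phi>"
proof -
  have main: "norm (\<phi> t - \<phi> s) \<le> L * (t - s)" if st: "a \<le> s" "s \<le> t" "t \<le> b" for s t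
  proof (rule field_le_epsilon)
    fix e :: real assume e: "e > 0"
    \<comment> \<open>Split so that one \<epsilon> pays for the intervals tagged in the null set and
      \<open>\<epsilon> * (t - s)\<close> for the error of the difference quotients.\<close>
    define \<epsilon> where "\<epsilon> = e / (1 + (t - s))"
    have eps: "\<epsilon> > 0" "\<epsilon> + \<epsilon> * (t - s) = e"
    proof -
      show "\<epsilon> > 0" using e st by (simp add: \<epsilon>_def)
      have "\<epsilon> * (1 + (t - s)) = e" using st by (simp add: \<epsilon>_def)
      then show "\<epsilon> + \<epsilon> * (t - s) = e" by (simp add: algebra_simps)
    qed
    obtain \<eta> where \<eta>: "\<eta> > 0" and ac\<eta>: "\<And>D :: (real \<times> real) set. finite D \<Longrightarrow>
        (\<And>s t. (s, t) \<in> D \<Longrightarrow> a \<le> s \<and> s \<le> t \<and> t \<le> b) \<Longrightarrow>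
        disjoint_family_on (\<lambda>(s, t). {s<..<t}) D \<Longrightarrow> (\<Sum>(s, t)\<in>D. t - s) < \<eta> \<Longrightarrow>
        (\<Sum>(s, t)\<in>D. norm (\<phi> t - \<phi> s)) < \<epsilon>"
    proof -
      obtain \<eta> where "\<eta> > 0" "\<forall>D :: (real \<times> real) set.
          finite D \<and> (\<forall>(s, t)\<in>D. a \<le> s \<and> s \<le> t \<and> t \<le> b) \<and>
          disjoint_family_on (\<lambda>(s, t). {s<..<t}) D \<and> (\<Sum>(s, t)\<in>D. t - s) < \<eta>
          \<longrightarrow> (\<Sum>(s, t)\<in>D. norm (\<phi> t - \<phi> s)) < \<epsilon>"
        using ac[unfolded abs_continuous_on_interval_def, rule_format, OF eps(1)] by blast
      then show thesis by (intro that[of \<eta>]) auto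
    qed
    have "N \<in> null_sets lebesgue" using N by (simp add: negligible_iff_null_sets)
    \<comment> \<open>Outer regularity: an open set around the null set, small enough for absolute
      continuity to apply to any disjoint intervals inside it.\<close>
    then obtain T where T: "open T" "N \<subseteq> T" "T - N \<in> lmeasurable" "emeasure lebesgue (T - N) < ennreal \<eta>"
      using sets_lebesgue_outer_open[of N \<eta>] \<eta> by (metis null_setsD2)
    have Tm: "T \<in> lmeasurable" "measure lebesgue T < \<eta>"
    proof -
      have "T = (T - N) \<union> N" using T(2) by auto
      moreover have "(T - N) \<union> N \<in> lmeasurable"
        using T(3) N by (intro fmeasurable.Un) (auto simp: negligible_iff_measure)
      ultimately show "T \<in> lmeasurable" by simp
      have "emeasure lebesgue T = emeasure lebesgue (T - N)"
        using \<open>N \<in> null_sets lebesgue\<close> T(1) by (simp add: emeasure_Diff_null_set)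
      then have "measure lebesgue T = measure lebesgue (T - N)" by (simp add: measure_def)
      also have "\<dots> < \<eta>"
        using T(3,4) \<eta> by (simp add: emeasure_eq_measure2 ennreal_less_iff)
      finally show "measure lebesgue T < \<eta>" .
    qed
    have "\<exists>d>0. \<forall>y\<in>{a..b}. norm (y - x) < d \<longrightarrow> norm (\<phi> y - \<phi> x) \<le> (L + \<epsilon>) * \<bar>y - x\<bar>"
      if x: "x \<in> {a..b} - N" for x
    proof -
      have "\<exists>d>0. \<forall>y\<in>{a..b}. norm (y - x) < d \<longrightarrow>
          norm (\<phi> y - \<phi> x - (y - x) *\<^sub>R v x) \<le> \<epsilon> * norm (y - x)"
        using deriv[OF x] eps(1)
        unfolding has_vector_derivative_def has_derivative_within_alt by blast
      then obtain d where d: "d > 0" "\<forall>y\<in>{a..b}. norm (y - x) < d \<longrightarrow>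
          norm (\<phi> y - \<phi> x - (y - x) *\<^sub>R v x) \<le> \<epsilon> * norm (y - x)" by blast
      have "norm (\<phi> y - \<phi> x) \<le> (L + \<epsilon>) * \<bar>y - x\<bar>" if "y \<in> {a..b}" "norm (y - x) < d" for y
      proof -
        have "norm (\<phi> y - \<phi> x) \<le> norm (\<phi> y - \<phi> x - (y - x) *\<^sub>R v x) + norm ((y - x) *\<^sub>R v x)"
          using norm_triangle_ineq[of "\<phi> y - \<phi> x - (y - x) *\<^sub>R v x" "(y - x) *\<^sub>R v x"] by simp
        also have "\<dots> \<le> \<epsilon> * \<bar>y - x\<bar> + \<bar>y - x\<bar> * L"
          using d(2) that v[OF x] by (intro add_mono) (auto intro: mult_left_mono)
        finally show ?thesis by (simp add: algebra_simps)
      qed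
      then show ?thesis using d(1) by blast
    qed
    then obtain d where d: "\<And>x. x \<in> {a..b} - N \<Longrightarrow> d x > 0 \<and>
        (\<forall>y\<in>{a..b}. norm (y - x) < d x \<longrightarrow> norm (\<phi> y - \<phi> x) \<le> (L + \<epsilon>) * \<bar>y - x\<bar>)"
      by metis
    \<comment> \<open>Tags in N confine their interval to T, the others to a ball where the
      difference quotient is controlled. The radius 1 outside the interval only completes the
      gauge.\<close>
    define g where "g x = (if x \<in> N then T else if x \<in> {a..b} then ball x (d x) else ball x 1)" for x
    have "gauge g"
      unfolding gauge_def g_def using T d by auto
    then obtain p where p: "p tagged_division_of {s..t}" "g fine p"
      using fine_division_exists_real by blast
    note pD = tagged_division_ofD[OF p(1)]
    let ?f = "\<lambda>(x::real, K). \<phi> (Sup K) - \<phi> (Inf K)"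
    have K: "\<exists>c e. K = {c..e} \<and> c \<le> x \<and> x \<le> e \<and> s \<le> c \<and> e \<le> t \<and> Inf K = c \<and> Sup K = e"
      if xK: "(x, K) \<in> p" for x K
    proof -
      obtain c e where ce: "K = {c..e}" using pD(4)[OF xK] by auto
      have "c \<le> x" "x \<le> e" using pD(2)[OF xK] ce by auto
      moreover have "s \<le> c" "e \<le> t" using pD(3)[OF xK] ce calculation by (auto simp: subset_eq)
      ultimately show ?thesis using ce by auto
    qed
    \<comment> \<open>Degenerate intervals contribute nothing and are dropped. The others have
      nonempty, pairwise disjoint interiors, so passing to pairs of endpoints, as absolute
      continuity demands, is injective on P.\<close>
    define P where "P = {(x, K) \<in> p. x \<in> N \<and> measure lborel K \<noteq> 0}"
    define R where "R = {(x, K) \<in> p. x \<notin> N}"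
    have fin: "finite p" "finite P" "finite R" using pD(1)
      by (auto simp: P_def R_def intro: finite_subset[of _ p])
    have disj: "interior K1 \<inter> interior K2 = {}"
      if "(x1, K1) \<in> p" "(x2, K2) \<in> p" "(x1, K1) \<noteq> (x2, K2)" for x1 K1 x2 K2
      using pD(5) that by blast
    have "norm (\<phi> t - \<phi> s) = norm (sum ?f p)"
      using additive_tagged_division_1[of s t p \<phi>] st p by simp
    also have "\<dots> \<le> (\<Sum>z\<in>p. norm (?f z))" by (rule norm_sum)
    also have "\<dots> = (\<Sum>z\<in>P \<union> R. norm (?f z))"
    proof (rule sum.mono_neutral_right[OF fin(1)])
      show "\<forall>z\<in>p - (P \<union> R). norm (?f z) = 0"
      proof
        fix z assume "z \<in> p - (P \<union> R)"
        then obtain x K where z: "z = (x, K)" and xK: "(x, K) \<in> p" "(x, K) \<notin> P \<union> R"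
          by (cases z) auto
        then have "measure lborel K = 0" by (auto simp: P_def R_def)
        moreover obtain c e where "K = {c..e}" "c \<le> x" "x \<le> e" "Inf K = c" "Sup K = e"
          using K[OF xK(1)] by blast
        ultimately show "norm (?f z) = 0" using z by simp
      qed
    qed (auto simp: P_def R_def)
    also have "\<dots> = (\<Sum>z\<in>P. norm (?f z)) + (\<Sum>z\<in>R. norm (?f z))"
      using fin by (intro sum.union_disjoint) (auto simp: P_def R_def)
    also have "(\<Sum>z\<in>R. norm (?f z)) \<le> (\<Sum>(x, K)\<in>R. (L + \<epsilon>) * measure lborel K)"
    proof (rule sum_mono)
      fix z assume "z \<in> R"
      then obtain x K where z: "z = (x, K)" and xK: "(x, K) \<in> p" "x \<notin> N" by (auto simp: R_def)
      obtain c e where ce: "K = {c..e}" "c \<le> x" "x \<le> e" "s \<le> c" "e \<le> t" "Inf K = c" "Sup K = e"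
        using K[OF xK(1)] by blast
      have x: "x \<in> {a..b} - N" using ce st xK by auto
      have "K \<subseteq> ball x (d x)"
        using fineD[OF p(2) xK(1)] x by (simp add: g_def)
      moreover have "c \<in> K" "e \<in> K" using ce by auto
      ultimately have "c \<in> ball x (d x)" "e \<in> ball x (d x)" by blast+
      then have "norm (\<phi> c - \<phi> x) \<le> (L + \<epsilon>) * \<bar>c - x\<bar>" "norm (\<phi> e - \<phi> x) \<le> (L + \<epsilon>) * \<bar>e - x\<bar>"
        using d[OF x, THEN conjunct2, rule_format, of c] d[OF x, THEN conjunct2, rule_format, of e] ce st
        by (simp_all add: dist_real_def abs_minus_commute)
      moreover have "norm (\<phi> e - \<phi> c) \<le> norm (\<phi> c - \<phi> x) + norm (\<phi> e - \<phi> x)"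
        using norm_triangle_ineq4[of "\<phi> e - \<phi> x" "\<phi> c - \<phi> x"] by simp
      ultimately have "norm (\<phi> e - \<phi> c) \<le> (L + \<epsilon>) * (x - c) + (L + \<epsilon>) * (e - x)"
        using ce by simp
      also have "\<dots> = (L + \<epsilon>) * (e - c)" by (simp add: algebra_simps)
      finally show "norm (?f z) \<le> (case z of (x, K) \<Rightarrow> (L + \<epsilon>) * measure lborel K)"
        using ce z by simp
    qed
    also have "\<dots> \<le> (\<Sum>(x, K)\<in>p. (L + \<epsilon>) * measure lborel K)"
      using fin L eps by (intro sum_mono2) (auto simp: R_def)
    also have "\<dots> = (L + \<epsilon>) * (t - s)"
      using additive_content_tagged_division[of p s t] p st
      by (simp add: sum_distrib_left[symmetric] case_prod_unfold)
    also have "(\<Sum>z\<in>P. norm (?f z)) < \<epsilon>"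
    proof -
      define \<iota> where "\<iota> = (\<lambda>(x::real, K). (Inf K :: real, Sup K :: real))"
      have Pint: "interior (snd z) = {fst (\<iota> z)<..<snd (\<iota> z)}" "interior (snd z) \<noteq> {}"
        "a \<le> fst (\<iota> z)" "fst (\<iota> z) \<le> snd (\<iota> z)" "snd (\<iota> z) \<le> b" "snd z \<subseteq> T" if "z \<in> P" for z
      proof -
        obtain x K' where z: "z = (x, K')" "(x, K') \<in> p" "x \<in> N" "measure lborel K' \<noteq> 0"
          using \<open>z \<in> P\<close> by (auto simp: P_def)
        obtain c e where ce: "K' = {c..e}" "c \<le> x" "x \<le> e" "s \<le> c" "e \<le> t" "Inf K' = c" "Sup K' = e"
          using K[OF z(2)] by blast
        have "c < e" using ce z by (cases "c = e") auto
        then show "interior (snd z) = {fst (\<iota> z)<..<snd (\<iota> z)}" "interior (snd z) \<noteq> {}"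
          "a \<le> fst (\<iota> z)" "fst (\<iota> z) \<le> snd (\<iota> z)" "snd (\<iota> z) \<le> b"
          using ce z st by (auto simp: \<iota>_def)
        show "snd z \<subseteq> T" using fineD[OF p(2) z(2)] z by (simp add: g_def)
      qed
      have Pdisj: "interior (snd z) \<inter> interior (snd w) = {}" if "z \<in> P" "w \<in> P" "z \<noteq> w" for z w
        using that disj[of "fst z" "snd z" "fst w" "snd w"] by (auto simp: P_def)
      have inj: "inj_on \<iota> P"
      proof (rule inj_onI, rule ccontr)
        fix z w assume zw: "z \<in> P" "w \<in> P" "\<iota> z = \<iota> w" "z \<noteq> w"
        then have "interior (snd z) = interior (snd w)" using Pint(1) by simp
        then show False using Pdisj[OF zw(1,2,4)] Pint(2)[OF zw(1)] by auto
      qed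
      have "(\<Sum>(c, e)\<in>\<iota> ` P. e - c) = (\<Sum>z\<in>P. snd (\<iota> z) - fst (\<iota> z))"
        by (simp add: sum.reindex[OF inj] case_prod_unfold)
      also have "\<dots> = (\<Sum>z\<in>P. measure lebesgue (interior (snd z)))"
        using Pint by (intro sum.cong) auto
      also have "\<dots> = measure lebesgue (\<Union>z\<in>P. interior (snd z))"
      proof (rule measure_UNION'[symmetric])
        show "pairwise (\<lambda>x y. disjnt (interior (snd x)) (interior (snd y))) P"
          using Pdisj by (auto simp: pairwise_def disjnt_def)
      qed (use fin Pint in auto)
      also have "\<dots> \<le> measure lebesgue T"
      proof (rule measure_mono_fmeasurable[OF _ _ Tm(1)])
        show "(\<Union>z\<in>P. interior (snd z)) \<subseteq> T"
          using Pint(6) interior_subset by blast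
        show "(\<Union>z\<in>P. interior (snd z)) \<in> sets lebesgue"
        proof (rule sets_completionI_sets)
          have "open (\<Union>z\<in>P. interior (snd z))" by auto
          then show "(\<Union>z\<in>P. interior (snd z)) \<in> sets lborel" by simp
        qed
      qed
      also have "\<dots> < \<eta>" by (rule Tm)
      finally have small: "(\<Sum>(c, e)\<in>\<iota> ` P. e - c) < \<eta>" .
      have "(\<Sum>(c, e)\<in>\<iota> ` P. norm (\<phi> e - \<phi> c)) < \<epsilon>"
      proof (rule ac\<eta>[OF _ _ _ small])
        show "disjoint_family_on (\<lambda>(s, t). {s<..<t}) (\<iota> ` P)"
          unfolding disjoint_family_on_def
        proof (intro ballI impI)
          fix m m' assume "m \<in> \<iota> ` P" "m' \<in> \<iota> ` P" "m \<noteq> m'"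
          then obtain z w where zw: "z \<in> P" "w \<in> P" "m = \<iota> z" "m' = \<iota> w" "z \<noteq> w" by blast
          then show "(case m of (s, t) \<Rightarrow> {s<..<t}) \<inter> (case m' of (s, t) \<Rightarrow> {s<..<t}) = {}"
            using Pdisj[OF zw(1,2,5)] unfolding Pint(1)[OF zw(1)] Pint(1)[OF zw(2)]
            by (simp add: case_prod_unfold)
        qed
        show "a \<le> c \<and> c \<le> e \<and> e \<le> b" if "(c, e) \<in> \<iota> ` P" for c e
          using that Pint(3-5) by (metis fst_conv imageE snd_conv)
      qed (use fin in auto)
      also have "(\<Sum>(c, e)\<in>\<iota> ` P. norm (\<phi> e - \<phi> c)) = (\<Sum>z\<in>P. norm (?f z))"
        using sum.reindex[OF inj, of "\<lambda>(c, e). norm (\<phi> e - \<phi> c)"]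
        by (simp add: case_prod_unfold \<iota>_def o_def)
      finally show ?thesis .
    qed
    finally have "norm (\<phi> t - \<phi> s) \<le> \<epsilon> + (L + \<epsilon>) * (t - s)" by simp
    also have "\<dots> = L * (t - s) + (\<epsilon> + \<epsilon> * (t - s))" by (simp add: algebra_simps)
    finally show "norm (\<phi> t - \<phi> s) \<le> L * (t - s) + e" using eps(2) by simp
  qed
  show ?thesis
  proof (rule lipschitz_onI[OF _ L])
    fix x y assume "x \<in> {a..b}" "y \<in> {a..b}"
    then show "dist (\<phi> x) (\<phi> y) \<le> L * dist x y"
      using main[of x y] main[of y x]
      by (cases "x \<le> y") (auto simp: dist_norm norm_minus_commute)
  qed
qed

lemma lipschitz_imp_abs_continuous:
  fixes \<phi> :: "real \<Rightarrow> real^'p::finite"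
  assumes "L-lipschitz_on {a..b} \<phi>"
  shows "abs_continuous_on_interval a b \<phi>"
  unfolding abs_continuous_on_interval_def
proof (intro allI impI)
  fix \<epsilon> :: real assume e: "\<epsilon> > 0"
  have L: "L \<ge> 0" using assms by (rule lipschitz_on_nonneg)
  show "\<exists>\<eta>>0. \<forall>D. finite D \<and> (\<forall>(s, t)\<in>D. a \<le> s \<and> s \<le> t \<and> t \<le> b) \<and>
      disjoint_family_on (\<lambda>(s, t). {s<..<t}) D \<and> (\<Sum>(s, t)\<in>D. t - s) < \<eta> \<longrightarrow>
      (\<Sum>(s, t)\<in>D. norm (\<phi> t - \<phi> s)) < \<epsilon>"
  \<comment> \<open>\<open>L + 1\<close> instead of L keeps the quotient meaningful for L =
    0.\<close>
  proof (intro exI[of _ "\<epsilon> / (L + 1)"] conjI allI impI)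
    show "0 < \<epsilon> / (L + 1)" using e L by simp
    fix D :: "(real \<times> real) set"
    assume D: "finite D \<and> (\<forall>(s, t)\<in>D. a \<le> s \<and> s \<le> t \<and> t \<le> b) \<and>
      disjoint_family_on (\<lambda>(s, t). {s<..<t}) D \<and> (\<Sum>(s, t)\<in>D. t - s) < \<epsilon> / (L + 1)"
    have "(\<Sum>(s, t)\<in>D. norm (\<phi> t - \<phi> s)) \<le> (\<Sum>(s, t)\<in>D. (L + 1) * (t - s))"
    proof (rule sum_mono, clarify)
      fix s t assume "(s, t) \<in> D"
      then have st: "a \<le> s" "s \<le> t" "t \<le> b" using D by auto
      then have "norm (\<phi> t - \<phi> s) \<le> L * (t - s)"
        using lipschitz_onD[OF assms, of t s] by (auto simp: dist_norm)
      also have "\<dots> \<le> (L + 1) * (t - s)" using st by (intro mult_right_mono) auto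
      finally show "norm (\<phi> t - \<phi> s) \<le> (L + 1) * (t - s)" .
    qed
    also have "\<dots> = (L + 1) * (\<Sum>(s, t)\<in>D. t - s)"
      by (simp add: sum_distrib_left case_prod_unfold)
    also have "\<dots> < (L + 1) * (\<epsilon> / (L + 1))" using D L by (intro mult_strict_left_mono) auto
    also have "\<dots> = \<epsilon>" using L by simp
    finally show "(\<Sum>(s, t)\<in>D. norm (\<phi> t - \<phi> s)) < \<epsilon>" .
  qed
qed

section \<open>Gluing and reparametrizing curves\<close>

text \<open>A form of admissibility suited to cutting and pasting: any interval, any bounds w on the
  controls, controls defined on the whole line, derivatives only at interior points, and a Lipschitz
  condition in place of absolute continuity because it survives gluing with an explicit
  constant.\<close>

definition horizontal_curve ::
  "(real^'p::finite) set \<Rightarrow> 'i set \<Rightarrow> ('i \<Rightarrow> real^'p \<Rightarrow> real^'p) \<Rightarrow> ('i \<Rightarrow> real) \<Rightarrow> real \<Rightarrow> real \<Rightarrow>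
    (real \<Rightarrow> real^'p) \<Rightarrow> bool" where
  "horizontal_curve \<Omega> S Y w a b \<phi> \<longleftrightarrow>
     \<phi> ` {a..b} \<subseteq> \<Omega> \<and> (\<exists>L. L-lipschitz_on {a..b} \<phi>) \<and>
     (\<exists>u N. (\<forall>I\<in>S. u I \<in> borel_measurable lebesgue \<and> (\<forall>t. \<bar>u I t\<bar> \<le> w I)) \<and> negligible N \<and>
        (\<forall>t\<in>{a<..<b} - N. (\<phi> has_vector_derivative (\<Sum>I\<in>S. u I t *\<^sub>R Y I (\<phi> t))) (at t)))"

lemma horizontal_curveE:
  assumes "horizontal_curve \<Omega> S Y w a b \<phi>"
  obtains L N u where "\<phi> ` {a..b} \<subseteq> \<Omega>" "L-lipschitz_on {a..b} \<phi>" "negligible N"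
    "\<And>I. I \<in> S \<Longrightarrow> u I \<in> borel_measurable lebesgue" "\<And>I t. I \<in> S \<Longrightarrow> \<bar>u I t\<bar> \<le> w I"
    "\<And>t. t \<in> {a<..<b} - N \<Longrightarrow>
      (\<phi> has_vector_derivative (\<Sum>I\<in>S. u I t *\<^sub>R Y I (\<phi> t))) (at t)"
  using assms unfolding horizontal_curve_def by blast

lemma horizontal_curveI:
  assumes "\<phi> ` {a..b} \<subseteq> \<Omega>" "L-lipschitz_on {a..b} \<phi>" "negligible N"
    "\<forall>I\<in>S. u I \<in> borel_measurable lebesgue \<and> (\<forall>t. \<bar>u I t\<bar> \<le> w I)"
    "\<forall>t\<in>{a<..<b} - N. (\<phi> has_vector_derivative (\<Sum>I\<in>S. u I t *\<^sub>R Y I (\<phi> t))) (at t)"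
  shows "horizontal_curve \<Omega> S Y w a b \<phi>"
  unfolding horizontal_curve_def using assms
  by (intro conjI exI[of _ L] exI[of _ u] exI[of _ N])

lemma lebesgue_measurable_affine_comp:
  fixes f :: "real \<Rightarrow> real"
  assumes "f \<in> borel_measurable lebesgue" "c \<noteq> 0"
  shows "(\<lambda>t. f (c * t + d)) \<in> borel_measurable lebesgue"
proof -
  have "(\<lambda>t::real. d + (\<Sum>j\<in>Basis. (c * (t \<bullet> j)) *\<^sub>R j)) \<in> lebesgue \<rightarrow>\<^sub>M lebesgue"
    using assms(2) by (intro lebesgue_affine_measurable) auto
  then have "(\<lambda>t. c * t + d) \<in> lebesgue \<rightarrow>\<^sub>M lebesgue" by (simp add: add.commute)
  then show ?thesis using measurable_compose assms(1) by blast
qed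

lemma negligible_affine_vimage:
  fixes N :: "real set"
  assumes "negligible N" "c \<noteq> 0"
  shows "negligible {t. c * t + d \<in> N}"
proof -
  have "{t. c * t + d \<in> N} \<subseteq> (\<lambda>s. (s - d) / c) ` N"
  proof
    fix t assume "t \<in> {t. c * t + d \<in> N}"
    then show "t \<in> (\<lambda>s. (s - d) / c) ` N"
      using assms(2) by (intro image_eqI[of _ _ "c * t + d"]) auto
  qed
  moreover have "negligible ((\<lambda>s. (s - d) / c) ` N)"
    by (rule negligible_differentiable_image_negligible)
      (use assms in \<open>auto simp: divide_inverse intro!: differentiable_on_mult differentiable_on_diff\<close>)
  ultimately show ?thesis by (rule negligible_subset[rotated])
qed

text \<open>By the chain rule the controls become \<open>c * u I (c * t + d)\<close>, so their
  bounds scale by \<bar>c\<bar>. Negative c is allowed: c = -1 gives time reversal.\<close>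

lemma horizontal_curve_affine:
  assumes h: "horizontal_curve \<Omega> S Y w a b \<phi>" and c: "c \<noteq> 0"
    and into: "\<And>t. t \<in> {a'..b'} \<Longrightarrow> c * t + d \<in> {a..b}"
      "\<And>t. t \<in> {a'<..<b'} \<Longrightarrow> c * t + d \<in> {a<..<b}"
    and w': "\<And>I. I \<in> S \<Longrightarrow> \<bar>c\<bar> * w I \<le> w' I"
  shows "horizontal_curve \<Omega> S Y w' a' b' (\<lambda>t. \<phi> (c * t + d))"
proof -
  obtain L N u where h': "\<phi> ` {a..b} \<subseteq> \<Omega>" "L-lipschitz_on {a..b} \<phi>" "negligible N"
    and u: "\<And>I. I \<in> S \<Longrightarrow> u I \<in> borel_measurable lebesgue" "\<And>I t. I \<in> S \<Longrightarrow> \<bar>u I t\<bar> \<le> w I"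
    and deriv: "\<And>t. t \<in> {a<..<b} - N \<Longrightarrow>
      (\<phi> has_vector_derivative (\<Sum>I\<in>S. u I t *\<^sub>R Y I (\<phi> t))) (at t)"
    by (rule horizontal_curveE[OF h]) (rule that; simp)
  have "(L * \<bar>c\<bar>)-lipschitz_on {a'..b'} (\<lambda>t. \<phi> (c * t + d))"
  proof (rule lipschitz_onI)
    fix s t assume st: "s \<in> {a'..b'}" "t \<in> {a'..b'}"
    have "dist (\<phi> (c * s + d)) (\<phi> (c * t + d)) \<le> L * dist (c * s + d) (c * t + d)"
      using lipschitz_onD[OF h'(2)] into(1) st by blast
    also have "dist (c * s + d) (c * t + d) = \<bar>c\<bar> * dist s t"
      by (simp add: dist_real_def abs_mult[symmetric] algebra_simps)
    finally show "dist (\<phi> (c * s + d)) (\<phi> (c * t + d)) \<le> L * \<bar>c\<bar> * dist s t"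
      by (simp add: mult.assoc)
  qed (use lipschitz_on_nonneg[OF h'(2)] in auto)
  moreover have "(\<lambda>t. \<phi> (c * t + d)) ` {a'..b'} \<subseteq> \<Omega>" using h'(1) into(1) by blast
  moreover have "\<forall>I\<in>S. (\<lambda>t. c * u I (c * t + d)) \<in> borel_measurable lebesgue \<and>
      (\<forall>t. \<bar>c * u I (c * t + d)\<bar> \<le> w' I)"
  proof (intro ballI conjI allI)
    fix I t assume I: "I \<in> S"
    show "(\<lambda>t. c * u I (c * t + d)) \<in> borel_measurable lebesgue"
      using lebesgue_measurable_affine_comp[OF u(1)[OF I] c] by measurable
    have "\<bar>c * u I (c * t + d)\<bar> \<le> \<bar>c\<bar> * w I"
      using u(2)[OF I] by (simp add: abs_mult mult_left_mono)
    then show "\<bar>c * u I (c * t + d)\<bar> \<le> w' I" using w'[OF I] by simp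
  qed
  moreover have "\<forall>t\<in>{a'<..<b'} - {t. c * t + d \<in> N}. ((\<lambda>t. \<phi> (c * t + d)) has_vector_derivative
      (\<Sum>I\<in>S. (c * u I (c * t + d)) *\<^sub>R Y I (\<phi> (c * t + d)))) (at t)"
  proof
    fix t assume t: "t \<in> {a'<..<b'} - {t. c * t + d \<in> N}"
    have "((\<lambda>t. c * t + d) has_vector_derivative c) (at t)"
      by (auto intro!: derivative_eq_intros)
    moreover have "(\<phi> has_vector_derivative
        (\<Sum>I\<in>S. u I (c * t + d) *\<^sub>R Y I (\<phi> (c * t + d)))) (at (c * t + d))"
      using deriv into(2) t by auto
    ultimately have "((\<phi> \<circ> (\<lambda>t. c * t + d)) has_vector_derivative
        c *\<^sub>R (\<Sum>I\<in>S. u I (c * t + d) *\<^sub>R Y I (\<phi> (c * t + d)))) (at t)"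
      by (rule vector_diff_chain_at)
    then show "((\<lambda>t. \<phi> (c * t + d)) has_vector_derivative
        (\<Sum>I\<in>S. (c * u I (c * t + d)) *\<^sub>R Y I (\<phi> (c * t + d)))) (at t)"
      by (simp add: o_def scaleR_sum_right)
  qed
  ultimately show ?thesis
    using negligible_affine_vimage[OF h'(3) c, of d]
    by (intro horizontal_curveI[where N = "{t. c * t + d \<in> N}" and
          u = "\<lambda>I t. c * u I (c * t + d)"])
qed

lemma horizontal_curve_glue:
  assumes f: "horizontal_curve \<Omega> S Y w a b \<phi>" and g: "horizontal_curve \<Omega> S Y w b c \<psi>"
    and eq: "\<phi> b = \<psi> b"
  shows "horizontal_curve \<Omega> S Y w a c (\<lambda>t. if t \<le> b then \<phi> t else \<psi> t)"
proof -
  obtain L N u where f': "\<phi> ` {a..b} \<subseteq> \<Omega>" "L-lipschitz_on {a..b} \<phi>" "negligible N"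
    and u: "\<And>I. I \<in> S \<Longrightarrow> u I \<in> borel_measurable lebesgue" "\<And>I t. I \<in> S \<Longrightarrow> \<bar>u I t\<bar> \<le> w I"
    and derivu: "\<And>t. t \<in> {a<..<b} - N \<Longrightarrow>
      (\<phi> has_vector_derivative (\<Sum>I\<in>S. u I t *\<^sub>R Y I (\<phi> t))) (at t)"
    by (rule horizontal_curveE[OF f]) (rule that; simp)
  obtain M K v where g': "\<psi> ` {b..c} \<subseteq> \<Omega>" "M-lipschitz_on {b..c} \<psi>" "negligible K"
    and v: "\<And>I. I \<in> S \<Longrightarrow> v I \<in> borel_measurable lebesgue" "\<And>I t. I \<in> S \<Longrightarrow> \<bar>v I t\<bar> \<le> w I"
    and derivv: "\<And>t. t \<in> {b<..<c} - K \<Longrightarrow>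
      (\<psi> has_vector_derivative (\<Sum>I\<in>S. v I t *\<^sub>R Y I (\<psi> t))) (at t)"
    by (rule horizontal_curveE[OF g]) (rule that; simp)
  let ?\<theta> = "\<lambda>t. if t \<le> b then \<phi> t else \<psi> t" and ?z = "\<lambda>I t. if t \<le> b then u I t else v I t"
  have "(max L M)-lipschitz_on {a..c} ?\<theta>"
    using lipschitz_on_concat_max[OF f'(2) g'(2) eq] .
  moreover have "?\<theta> ` {a..c} \<subseteq> \<Omega>" using f'(1) g'(1) by force
  moreover have "\<forall>I\<in>S. ?z I \<in> borel_measurable lebesgue \<and> (\<forall>t. \<bar>?z I t\<bar> \<le> w I)"
  proof (intro ballI conjI allI)
    fix I t assume I: "I \<in> S"
    have "{t. t \<le> b} \<in> sets lebesgue" by (simp add: atMost_def[symmetric])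
    then show "?z I \<in> borel_measurable lebesgue"
      using u(1)[OF I] v(1)[OF I] by (intro measurable_If) auto
    show "\<bar>?z I t\<bar> \<le> w I" using u(2)[OF I] v(2)[OF I] by auto
  qed
  \<comment> \<open>The two pieces may meet at a corner, so b joins the exceptional set.\<close>
  moreover have "negligible (N \<union> K \<union> {b})" using f'(3) g'(3) by auto
  moreover have "\<forall>t\<in>{a<..<c} - (N \<union> K \<union> {b}).
      (?\<theta> has_vector_derivative (\<Sum>I\<in>S. ?z I t *\<^sub>R Y I (?\<theta> t))) (at t)"
  proof
    fix t assume t: "t \<in> {a<..<c} - (N \<union> K \<union> {b})"
    show "(?\<theta> has_vector_derivative (\<Sum>I\<in>S. ?z I t *\<^sub>R Y I (?\<theta> t))) (at t)"
    proof (cases "t < b")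
      case True
      have "(\<phi> has_vector_derivative (\<Sum>I\<in>S. u I t *\<^sub>R Y I (\<phi> t))) (at t)"
        using derivu t True by auto
      then have "(?\<theta> has_vector_derivative (\<Sum>I\<in>S. u I t *\<^sub>R Y I (\<phi> t))) (at t)"
        by (rule has_vector_derivative_transform_within_open[where S = "{..<b}"]) (use True in auto)
      then show ?thesis using True by simp
    next
      case False
      then have "t > b" using t by auto
      have "(\<psi> has_vector_derivative (\<Sum>I\<in>S. v I t *\<^sub>R Y I (\<psi> t))) (at t)"
        using derivv t \<open>t > b\<close> by auto
      then have "(?\<theta> has_vector_derivative (\<Sum>I\<in>S. v I t *\<^sub>R Y I (\<psi> t))) (at t)"
        by (rule has_vector_derivative_transform_within_open[where S = "{b<..}"])
          (use \<open>t > b\<close> in auto)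
      then show ?thesis using \<open>t > b\<close> by simp
    qed
  qed
  ultimately show ?thesis by (intro horizontal_curveI[where u = ?z])
qed

section \<open>Admissible curves as horizontal curves\<close>

definition fields_bounded ::
  "(real^'p::finite) set \<Rightarrow> nat \<Rightarrow> nat \<Rightarrow> (nat \<Rightarrow> real^'p \<Rightarrow> real^'p) \<Rightarrow> real \<Rightarrow> bool" where
  "fields_bounded \<Omega> n r X B \<longleftrightarrow> B \<ge> 0 \<and>
     (\<forall>I\<in>multiindices n r. \<forall>x\<in>\<Omega>. norm (iter_commutator X I x) \<le> B)"

lemma AE_lebesgue_on_Icc_iff:
  fixes a b :: real
  shows "(AE t in lebesgue_on {a..b}. P t) \<longleftrightarrow> (\<exists>N. negligible N \<and> (\<forall>t\<in>{a..b} - N. P t))"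
proof -
  have "(AE t in lebesgue_on {a..b}. P t) \<longleftrightarrow> (AE t in lebesgue. t \<in> {a..b} \<longrightarrow> P t)"
    by (rule AE_restrict_space_iff) simp
  also have "\<dots> \<longleftrightarrow> (\<exists>N. negligible N \<and> {t. \<not> (t \<in> {a..b} \<longrightarrow> P t)} \<subseteq> N)"
    by (simp add: eventually_ae_filter negligible_iff_null_sets Bex_def)
  also have "\<dots> \<longleftrightarrow> (\<exists>N. negligible N \<and> (\<forall>t\<in>{a..b} - N. P t))" by blast
  finally show ?thesis .
qed

lemma norm_horizontal_velocity_le:
  assumes B: "fields_bounded \<Omega> n r X B" and x: "x \<in> \<Omega>"
    and a: "\<And>I. I \<in> multiindices n r \<Longrightarrow> \<bar>a I\<bar> \<le> \<delta> ^ weight I"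
  shows "norm (\<Sum>I\<in>multiindices n r. a I *\<^sub>R iter_commutator X I x)
    \<le> B * (\<Sum>I\<in>multiindices n r. \<delta> ^ weight I)"
proof -
  have "norm (\<Sum>I\<in>multiindices n r. a I *\<^sub>R iter_commutator X I x)
      \<le> (\<Sum>I\<in>multiindices n r. B * \<delta> ^ weight I)"
  proof (rule sum_norm_le)
    fix I assume I: "I \<in> multiindices n r"
    have "\<bar>a I\<bar> * norm (iter_commutator X I x) \<le> \<delta> ^ weight I * B"
      using a[OF I] B I x by (intro mult_mono) (auto simp: fields_bounded_def)
    then show "norm (a I *\<^sub>R iter_commutator X I x) \<le> B * \<delta> ^ weight I" by (simp add: mult.commute)
  qed
  then show ?thesis by (simp add: sum_distrib_left)
qed

text \<open>The step from almost everywhere to everywhere: absolute continuity turns the bound on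
  the velocity into a Lipschitz constant. Its explicit form in B and \<delta> is what later yields
  the lower bound on the distance.\<close>

lemma admissible_curve_lipschitz:
  assumes B: "fields_bounded \<Omega> n r X B" and "\<delta> \<ge> 0" and \<phi>: "\<phi> \<in> admissible_curves \<Omega> n r X \<delta>"
  shows "(B * (\<Sum>I\<in>multiindices n r. \<delta> ^ weight I))-lipschitz_on {0..1} \<phi>"
proof -
  obtain a N where "\<phi> ` {0..1} \<subseteq> \<Omega>" "abs_continuous_on_interval 0 1 \<phi>" and N: "negligible N"
    and a: "\<And>I t. I \<in> multiindices n r \<Longrightarrow> t \<in> {0..1} \<Longrightarrow> \<bar>a I t\<bar> \<le> \<delta> ^ weight I"
    and d: "\<And>t. t \<in> {0..1} - N \<Longrightarrow> (\<phi> has_vector_derivative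
        (\<Sum>I\<in>multiindices n r. a I t *\<^sub>R iter_commutator X I (\<phi> t))) (at t within {0..1})"
    using \<phi> unfolding admissible_curves_def AE_lebesgue_on_Icc_iff by blast
  then show ?thesis
    using B \<open>\<delta> \<ge> 0\<close>
    by (intro abs_continuous_imp_lipschitz[OF _ N d] norm_horizontal_velocity_le[OF B] mult_nonneg_nonneg sum_nonneg)
      (auto simp: fields_bounded_def)
qed

text \<open>This transfers reparametrization and gluing to the class in the definition of d. The
  endpoints 0 and 1 go into the null set, which reconciles one-sided with two-sided
  derivatives.\<close>

lemma admissible_curve_iff_horizontal:
  assumes B: "fields_bounded \<Omega> n r X B" and \<delta>: "\<delta> \<ge> 0"
  shows "\<phi> \<in> admissible_curves \<Omega> n r X \<delta> \<longleftrightarrow>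
    horizontal_curve \<Omega> (multiindices n r) (iter_commutator X) (\<lambda>I. \<delta> ^ weight I) 0 1 \<phi>"
    (is "?A \<longleftrightarrow> ?H")
proof
  assume A: ?A
  then obtain a N where \<phi>: "\<phi> ` {0..1} \<subseteq> \<Omega>" and N: "negligible N"
    and a: "\<And>I. I \<in> multiindices n r \<Longrightarrow> a I \<in> borel_measurable (lebesgue_on {0..1})"
      "\<And>I t. I \<in> multiindices n r \<Longrightarrow> t \<in> {0..1} \<Longrightarrow> \<bar>a I t\<bar> \<le> \<delta> ^ weight I"
    and d: "\<And>t. t \<in> {0..1} - N \<Longrightarrow> (\<phi> has_vector_derivative
        (\<Sum>I\<in>multiindices n r. a I t *\<^sub>R iter_commutator X I (\<phi> t))) (at t within {0..1})"
    unfolding admissible_curves_def AE_lebesgue_on_Icc_iff by blast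
  \<comment> \<open>Extension by 0 respects the bounds because \<open>\<delta> ^ weight I\<close> is
    nonnegative.\<close>
  define u where "u I t = (if t \<in> {0..1} then a I t else 0)" for I t
  have "\<forall>I\<in>multiindices n r. u I \<in> borel_measurable lebesgue \<and> (\<forall>t. \<bar>u I t\<bar> \<le> \<delta> ^ weight I)"
    using a \<delta> borel_measurable_if[of "{0..1::real}"] by (auto simp: u_def[abs_def])
  moreover have "\<forall>t\<in>{0<..<1} - N. (\<phi> has_vector_derivative
        (\<Sum>I\<in>multiindices n r. u I t *\<^sub>R iter_commutator X I (\<phi> t))) (at t)"
  proof
    fix t :: real assume t: "t \<in> {0<..<1} - N"
    then show "(\<phi> has_vector_derivative
        (\<Sum>I\<in>multiindices n r. u I t *\<^sub>R iter_commutator X I (\<phi> t))) (at t)"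
      using d[of t] by (simp add: u_def at_within_Icc_at)
  qed
  ultimately show ?H
    using \<phi> N admissible_curve_lipschitz[OF B \<delta> A] by (intro horizontal_curveI[where u = u])
next
  assume H: ?H
  obtain L N u where h: "\<phi> ` {0..1} \<subseteq> \<Omega>" "L-lipschitz_on {0..1} \<phi>" "negligible N"
    and u: "\<And>I. I \<in> multiindices n r \<Longrightarrow> u I \<in> borel_measurable lebesgue"
      "\<And>I t. I \<in> multiindices n r \<Longrightarrow> \<bar>u I t\<bar> \<le> \<delta> ^ weight I"
    and deriv: "\<And>t. t \<in> {0<..<1} - N \<Longrightarrow> (\<phi> has_vector_derivative
        (\<Sum>I\<in>multiindices n r. u I t *\<^sub>R iter_commutator X I (\<phi> t))) (at t)"
    by (rule horizontal_curveE[OF H]) (rule that; simp)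
  have "negligible (N \<union> {0, 1})" using h(3) by simp
  moreover have "\<forall>t\<in>{0..1} - (N \<union> {0, 1}). (\<phi> has_vector_derivative
        (\<Sum>I\<in>multiindices n r. u I t *\<^sub>R iter_commutator X I (\<phi> t))) (at t within {0..1})"
  proof
    fix t assume "t \<in> {0..1} - (N \<union> {0, 1})"
    then have "t \<in> {0<..<1} - N" by auto
    then show "(\<phi> has_vector_derivative
        (\<Sum>I\<in>multiindices n r. u I t *\<^sub>R iter_commutator X I (\<phi> t))) (at t within {0..1})"
      by (rule has_vector_derivative_at_within[OF deriv])
  qed
  moreover have "\<forall>I\<in>multiindices n r. u I \<in> borel_measurable (lebesgue_on {0..1}) \<and>
      (\<forall>t\<in>{0..1}. \<bar>u I t\<bar> \<le> \<delta> ^ weight I)"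
    using u by (auto intro: measurable_restrict_space1)
  ultimately show ?A
    using h(1) lipschitz_imp_abs_continuous[OF h(2)]
    unfolding admissible_curves_def AE_lebesgue_on_Icc_iff
    by (intro CollectI conjI exI[of _ u] exI[of _ "N \<union> {0, 1}"])
qed

section \<open>The control distance\<close>

lemma control_edist_lessE:
  assumes "control_edist \<Omega> n r X x y < ereal e"
  obtains \<delta> \<phi> where "\<delta> > 0" "\<delta> < e" "\<phi> \<in> admissible_curves \<Omega> n r X \<delta>" "\<phi> 0 = x" "\<phi> 1 = y"
  using assms unfolding control_edist_def Inf_less_iff by auto

lemma control_edist_leI:
  "\<delta> > 0 \<Longrightarrow> \<phi> \<in> admissible_curves \<Omega> n r X \<delta> \<Longrightarrow> \<phi> 0 = x \<Longrightarrow> \<phi> 1 = y \<Longrightarrow>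
    control_edist \<Omega> n r X x y \<le> ereal \<delta>"
  unfolding control_edist_def by (rule Inf_lower) auto

lemma control_edist_nonneg: "control_edist \<Omega> n r X x y \<ge> 0"
  unfolding control_edist_def by (rule Inf_greatest) auto

lemma control_edist_refl:
  assumes "x \<in> \<Omega>"
  shows "control_edist \<Omega> n r X x x = 0"
proof -
  have "control_edist \<Omega> n r X x x \<le> 0 + ereal \<delta>" if \<delta>: "\<delta> > 0" for \<delta>
  proof -
    have "(\<lambda>t::real. x) \<in> admissible_curves \<Omega> n r X \<delta>"
      unfolding admissible_curves_def using assms \<delta>
      by (auto intro!: exI[of _ "\<lambda>I t. 0"] lipschitz_imp_abs_continuous[of 0]
          simp: lipschitz_on_def has_vector_derivative_const)
    then show ?thesis using control_edist_leI[OF \<delta>, of "\<lambda>t. x"] by simp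
  qed
  then have "control_edist \<Omega> n r X x x \<le> 0" using ereal_le_epsilon2 by blast
  then show ?thesis using control_edist_nonneg by (rule antisym)
qed

text \<open>Running a curve backwards changes the sign of its controls, and the bounds on them are
  symmetric.\<close>

lemma control_edist_commute:
  assumes B: "fields_bounded \<Omega> n r X B"
  shows "control_edist \<Omega> n r X x y = control_edist \<Omega> n r X y x"
proof -
  have "control_edist \<Omega> n r X y x \<le> control_edist \<Omega> n r X x y" for x y
    unfolding control_edist_def[of _ _ _ _ x]
  proof (rule Inf_greatest, clarify)
    fix \<delta> \<phi> assume \<phi>: "\<delta> > 0" "\<phi> \<in> admissible_curves \<Omega> n r X \<delta>" 
    have "horizontal_curve \<Omega> (multiindices n r) (iter_commutator X) (\<lambda>I. \<delta> ^ weight I) 0 1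
        (\<lambda>t. \<phi> ((-1) * t + 1))"
      by (rule horizontal_curve_affine[where a = 0 and b = 1 and w = "\<lambda>I. \<delta> ^ weight I"])
        (use admissible_curve_iff_horizontal[OF B] \<phi> in auto)
    then have "(\<lambda>t. \<phi> ((-1) * t + 1)) \<in> admissible_curves \<Omega> n r X \<delta>"
      using admissible_curve_iff_horizontal[OF B] \<phi> by auto
    then show "control_edist \<Omega> n r X (\<phi> 1) (\<phi> 0) \<le> ereal \<delta>"
      using control_edist_leI[OF \<phi>(1), of "\<lambda>t. \<phi> ((-1) * t + 1)"] by simp
  qed
  then show ?thesis by (meson antisym)
qed

text \<open>The concatenation spends a share of time on each piece proportional to its \<open>\<delta>\<close>; since all
  weights are at least 1, the rescaled controls remain admissible.\<close>

lemma admissible_curve_concat: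
  assumes B: "fields_bounded \<Omega> n r X B" and pos: "\<delta> > 0" "\<epsilon> > 0"
    and \<phi>: "\<phi> \<in> admissible_curves \<Omega> n r X \<delta>" and \<psi>: "\<psi> \<in> admissible_curves \<Omega> n r X \<epsilon>"
    and eq: "\<phi> 1 = \<psi> 0"
  obtains \<theta> where "\<theta> \<in> admissible_curves \<Omega> n r X (\<delta> + \<epsilon>)" "\<theta> 0 = \<phi> 0" "\<theta> 1 = \<psi> 1"
proof -
  define s where "s = \<delta> + \<epsilon>"
  define l where "l = \<delta> / s"
  have s: "s > 0" "\<delta> \<le> s" "\<epsilon> \<le> s" using pos by (auto simp: s_def)
  have l: "0 < l" "l < 1" using pos by (auto simp: l_def s_def)
  have sl: "(s / \<delta>) * l = 1" "(s / \<epsilon>) * (1 - l) = 1"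
  proof -
    have "1 - l = \<epsilon> / s" using s(1) by (simp add: l_def s_def field_simps)
    then show "(s / \<delta>) * l = 1" "(s / \<epsilon>) * (1 - l) = 1" using pos s(1) by (auto simp: l_def)
  qed
  \<comment> \<open>Dividing by s and using weight k + 1, this is \<open>d ^ k \<le> s ^ k\<close>;
    weight 0 would break it.\<close>
  have scale: "(s / d) * d ^ weight I \<le> s ^ weight I"
    if "I \<in> multiindices n r" "0 < d" "d \<le> s" for I d
  proof -
    have "weight I \<ge> 1" using that weight_pos by (auto simp: multiindices_def)
    then obtain k where "weight I = Suc k" by (metis One_nat_def Suc_le_D)
    then show ?thesis using that s by (simp add: power_mono)
  qed
  have 1: "horizontal_curve \<Omega> (multiindices n r) (iter_commutator X) (\<lambda>I. s ^ weight I) 0 l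
      (\<lambda>t. \<phi> ((s / \<delta>) * t + 0))"
  proof (rule horizontal_curve_affine[where a = 0 and b = 1 and w = "\<lambda>I. \<delta> ^ weight I"])
    fix t
    show "t \<in> {0..l} \<Longrightarrow> (s / \<delta>) * t + 0 \<in> {0..1}" "t \<in> {0<..<l} \<Longrightarrow> (s / \<delta>) * t + 0 \<in> {0<..<1}"
      using mult_left_mono[of t l "s / \<delta>"] mult_strict_left_mono[of t l "s / \<delta>"] pos s
      unfolding sl(1) by auto
  qed (use \<phi> admissible_curve_iff_horizontal[OF B] pos s scale in auto)
  have 2: "horizontal_curve \<Omega> (multiindices n r) (iter_commutator X) (\<lambda>I. s ^ weight I) l 1
      (\<lambda>t. \<psi> ((s / \<epsilon>) * t + - (s / \<epsilon>) * l))"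
  proof (rule horizontal_curve_affine[where a = 0 and b = 1 and w = "\<lambda>I. \<epsilon> ^ weight I"])
    fix t
    have eq: "(s / \<epsilon>) * t + - (s / \<epsilon>) * l = (s / \<epsilon>) * (t - l)"
      by (simp add: right_diff_distrib)
    show "t \<in> {l..1} \<Longrightarrow> (s / \<epsilon>) * t + - (s / \<epsilon>) * l \<in> {0..1}"
      "t \<in> {l<..<1} \<Longrightarrow> (s / \<epsilon>) * t + - (s / \<epsilon>) * l \<in> {0<..<1}"
      using mult_left_mono[of "t - l" "1 - l" "s / \<epsilon>"]
        mult_strict_left_mono[of "t - l" "1 - l" "s / \<epsilon>"] pos s unfolding eq sl(2) by auto
  qed (use \<psi> admissible_curve_iff_horizontal[OF B] pos s scale in auto)
  have end2: "(s / \<epsilon>) * 1 + - (s / \<epsilon>) * l = 1"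
    using sl(2) unfolding right_diff_distrib by simp
  let ?\<theta> = "\<lambda>t. if t \<le> l then \<phi> ((s / \<delta>) * t + 0) else \<psi> ((s / \<epsilon>) * t + - (s / \<epsilon>) * l)"
  have "\<phi> ((s / \<delta>) * l + 0) = \<psi> ((s / \<epsilon>) * l + - (s / \<epsilon>) * l)"
    using eq unfolding sl(1) by simp
  then have "?\<theta> \<in> admissible_curves \<Omega> n r X s"
    using horizontal_curve_glue[OF 1 2] admissible_curve_iff_horizontal[OF B less_imp_le[OF s(1)]]
    by blast
  moreover have "?\<theta> 0 = \<phi> 0" "?\<theta> 1 = \<psi> 1"
    using l arg_cong[OF end2, of \<psi>] by simp_all
  ultimately show thesis using that by (auto simp: s_def)
qed

text \<open>Having no membership conditions on the points lets the distance be plugged directly into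
  \<open>connected_bounded_chain\<close>, which asks for the inequality everywhere.\<close>

lemma control_edist_triangle:
  assumes B: "fields_bounded \<Omega> n r X B"
  shows "control_edist \<Omega> n r X x z \<le> control_edist \<Omega> n r X x y + control_edist \<Omega> n r X y z"
proof (cases "control_edist \<Omega> n r X x y = \<infinity> \<or> control_edist \<Omega> n r X y z = \<infinity>")
  case True
  then show ?thesis using control_edist_nonneg by auto
next
  case False
  then obtain p q where pq: "control_edist \<Omega> n r X x y = ereal p" "control_edist \<Omega> n r X y z = ereal q"
    using control_edist_nonneg by (metis MInfty_neq_PInfty(1) ereal_cases ereal_infty_less_eq(2) 
        zero_ereal_def ereal.distinct(3))
  have "control_edist \<Omega> n r X x z \<le> ereal (p + q) + ereal e" if e: "e > 0" for e
  proof -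
    have "control_edist \<Omega> n r X x y < ereal (p + e/2)" "control_edist \<Omega> n r X y z < ereal (q + e/2)"
      using pq e by auto
    then obtain \<delta> \<phi> \<epsilon> \<psi> where *: "\<delta> > 0" "\<delta> < p + e/2" "\<phi> \<in> admissible_curves \<Omega> n r X \<delta>"
      "\<phi> 0 = x" "\<phi> 1 = y" "\<epsilon> > 0" "\<epsilon> < q + e/2" "\<psi> \<in> admissible_curves \<Omega> n r X \<epsilon>" "\<psi> 0 = y" "\<psi> 1 = z"
      by (elim control_edist_lessE)
    obtain \<theta> where "\<theta> \<in> admissible_curves \<Omega> n r X (\<delta> + \<epsilon>)" "\<theta> 0 = x" "\<theta> 1 = z"
      using admissible_curve_concat[OF B *(1,6,3,8)] * by metis
    then have "control_edist \<Omega> n r X x z \<le> ereal (\<delta> + \<epsilon>)" using * by (intro control_edist_leI[of "\<delta> + \<epsilon>" \<theta>]) auto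
    also have "\<dots> \<le> ereal (p + q) + ereal e" using * by simp
    finally show ?thesis .
  qed
  then show ?thesis using pq ereal_le_epsilon2 by (metis plus_ereal.simps(1))
qed

text \<open>For \<open>\<delta> \<le> 1\<close> the speed of an admissible curve is at most a multiple of \<open>\<delta>\<close> because all weights
  are at least 1; for \<open>\<delta> > 1\<close> the diameter of the domain is at most a multiple of \<open>\<delta>\<close>.\<close>

lemma control_edist_lower_bound:
  assumes "bounded \<Omega>"
  obtains c where "c > 0" "\<And>X x y. fields_bounded \<Omega> n r X B \<Longrightarrow>
    ereal (c * norm (x - y)) \<le> control_edist \<Omega> n r X x y"
proof -
  \<comment> \<open>Fixed from B and \<Omega> before any system is given. The added 1 makes it
    positive.\<close>
  define K where "K = max (B * card (multiindices n r)) (diameter \<Omega>) + 1"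
  have K: "K > 0" "diameter \<Omega> \<le> K" "B * card (multiindices n r) \<le> K"
    using diameter_ge_0[OF assms] by (auto simp: K_def)
  show thesis
  proof (rule that[of "1 / K"])
    fix X and x y :: "real^'a" assume B: "fields_bounded \<Omega> n r X B"
    show "ereal (1 / K * norm (x - y)) \<le> control_edist \<Omega> n r X x y"
      unfolding control_edist_def
    proof (rule Inf_greatest, clarify)
      fix \<delta> \<phi> assume \<delta>: "\<delta> > 0" and \<phi>: "\<phi> \<in> admissible_curves \<Omega> n r X \<delta>"
      have "norm (\<phi> 0 - \<phi> 1) \<le> K * \<delta>"
      proof (cases "\<delta> \<le> 1")
        case True
        have "norm (\<phi> 0 - \<phi> 1) \<le> B * (\<Sum>I\<in>multiindices n r. \<delta> ^ weight I)"
          using lipschitz_onD[OF admissible_curve_lipschitz[OF B _ \<phi>], of 0 1] \<delta> by (simp add: dist_norm)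
        also have "\<dots> \<le> B * (\<Sum>I\<in>multiindices n r. \<delta>)"
        proof (intro mult_left_mono sum_mono)
          fix I assume "I \<in> multiindices n r"
          then have "1 \<le> weight I" using weight_pos by (auto simp: multiindices_def)
          then show "\<delta> ^ weight I \<le> \<delta>" using power_decreasing[of 1 "weight I" \<delta>] True \<delta> by simp
        qed (use B in \<open>simp add: fields_bounded_def\<close>)
        also have "\<dots> = (B * card (multiindices n r)) * \<delta>" by simp
        also have "\<dots> \<le> K * \<delta>" using K(3) \<delta> by (intro mult_right_mono) auto
        finally show ?thesis .
      next
        case False
        have "\<phi> 0 \<in> \<Omega>" "\<phi> 1 \<in> \<Omega>" using \<phi> by (auto simp: admissible_curves_def)
        then have "norm (\<phi> 0 - \<phi> 1) \<le> diameter \<Omega>"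
          using diameter_bounded_bound[OF assms] by (simp add: dist_norm)
        also have "\<dots> \<le> K * 1" using K by simp
        also have "\<dots> \<le> K * \<delta>" using K False by (intro mult_left_mono) auto
        finally show ?thesis .
      qed
      then show "ereal (1 / K * norm (\<phi> 0 - \<phi> 1)) \<le> ereal \<delta>" using K(1) by (simp add: field_simps)
    qed
  qed (use K in auto)
qed

section \<open>The upper bound\<close>

text \<open>Leibniz formula: one term of size at most a product of E's for each permutation. It
  bounds the numerators in Cramer's rule.\<close>

lemma abs_det_le:
  fixes M :: "real^'q^'q"
  assumes "\<And>i j. \<bar>M $ i $ j\<bar> \<le> E"
  shows "\<bar>det M\<bar> \<le> fact CARD('q) * E ^ CARD('q)"
proof -
  have "\<bar>det M\<bar> \<le> (\<Sum>\<pi>\<in>{\<pi>. \<pi> permutes (UNIV :: 'q set)}. E ^ CARD('q))"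
    unfolding det_def
  proof (rule order_trans[OF sum_abs sum_mono])
    fix \<pi> :: "'q \<Rightarrow> 'q"
    have "\<bar>of_int (sign \<pi>) * (\<Prod>i\<in>UNIV. M $ i $ \<pi> i)\<bar> = (\<Prod>i\<in>UNIV. \<bar>M $ i $ \<pi> i\<bar>)"
      by (simp add: abs_mult sign_def abs_prod)
    also have "\<dots> \<le> (\<Prod>i\<in>(UNIV :: 'q set). E)"
      using assms by (intro prod_mono) auto
    finally show "\<bar>of_int (sign \<pi>) * (\<Prod>i\<in>UNIV. M $ i $ \<pi> i)\<bar> \<le> E ^ CARD('q)" by simp
  qed
  then show ?thesis by (simp add: card_permutations)
qed

lemma finite_index_tuples:
  "finite {J :: 'p::finite \<Rightarrow> nat list. range J \<subseteq> multiindices n r}"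
  using finite_set_of_finite_funs[OF finite[of "UNIV :: 'p set"] finite_multiindices[of n r], of undefined]
  by (rule finite_subset[rotated]) auto

lemma index_tuples_nonempty:
  assumes "r \<ge> 2"
  shows "{J :: 'p::finite \<Rightarrow> nat list. range J \<subseteq> multiindices n r} \<noteq> {}"
proof -
  \<comment> \<open>The index 0 is available for every n, including n = 0, and its weight 2 is at
    most r.\<close>
  have "[0] \<in> multiindices n r" using assms by (auto simp: multiindices_def weight_def wt_def)
  then show ?thesis by (auto intro!: exI[of _ "\<lambda>_. [0]"])
qed

lemma max_det_attained:
  fixes X :: "nat \<Rightarrow> real^'p::finite \<Rightarrow> real^'p"
  assumes "r \<ge> 2"
  obtains J :: "'p \<Rightarrow> nat list" where "range J \<subseteq> multiindices n r"
    "max_det n r X x = \<bar>det (\<chi> k. iter_commutator X (J k) x)\<bar>"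
proof -
  have "max_det n r X x \<in>
      (\<lambda>J :: 'p \<Rightarrow> nat list. \<bar>det (\<chi> k. iter_commutator X (J k) x)\<bar>) ` {J. range J \<subseteq> multiindices n r}"
    unfolding max_det_def
    using finite_index_tuples index_tuples_nonempty[OF assms] by (intro Max_in) auto
  then show ?thesis using that by auto
qed

lemma max_det_ge:
  fixes X :: "nat \<Rightarrow> real^'p::finite \<Rightarrow> real^'p"
  assumes "range J \<subseteq> multiindices n r"
  shows "\<bar>det (\<chi> k. iter_commutator X (J k) x)\<bar> \<le> max_det n r X x"
  unfolding max_det_def using assms finite_index_tuples by (intro Max_ge) auto

text \<open>A straight segment is admissible: where the determinant stays away from 0, its constant
  velocity is a combination of the commutators with coefficients given by Cramer's rule, and
  \<open>\<delta> ^ r\<close> bounds all the weights \<open>\<delta> ^ weight I\<close> from below when \<open>\<delta> \<le> 1\<close>.\<close>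

lemma segment_admissible:
  fixes X :: "nat \<Rightarrow> real^'p::finite \<Rightarrow> real^'p"
  assumes cont: "\<And>I k. I \<in> multiindices n r \<Longrightarrow> continuous_on \<Omega> (\<lambda>z. iter_commutator X I z $ k)"
    and E: "E \<ge> 1" "\<And>I k z. I \<in> multiindices n r \<Longrightarrow> z \<in> \<Omega> \<Longrightarrow> \<bar>iter_commutator X I z $ k\<bar> \<le> E"
    and J: "range J \<subseteq> multiindices n r" and seg: "closed_segment x y \<subseteq> \<Omega>"
    and m: "m > 0" "\<And>z. z \<in> closed_segment x y \<Longrightarrow> m \<le> \<bar>det (\<chi> k. iter_commutator X (J k) z)\<bar>"
    and \<delta>: "0 < \<delta>" "\<delta> \<le> 1"
      "CARD('p) * (fact CARD('p) * E ^ CARD('p) / m) * norm (y - x) \<le> \<delta> ^ r"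
  shows "linepath x y \<in> admissible_curves \<Omega> n r X \<delta>"
proof -
  \<comment> \<open>Normalizing the velocity keeps its components below 1 and hence below E, so the
    Cramer numerators obey a bound free of \<bar>x - y\<bar>. For x = y this is 0, which does no
    harm.\<close>
  define v where "v = (1 / norm (y - x)) *\<^sub>R (y - x)"
  have v: "norm (y - x) *\<^sub>R v = y - x" "norm v \<le> 1" by (auto simp: v_def)
  define A where "A z = (\<chi> i k. iter_commutator X (J k) z $ i)" for z
  \<comment> \<open>Cramer's rule: the l-th column of A is replaced by v. In A the commutators are
    columns, so it is the transpose of the matrix in the hypothesis on the minor.\<close>
  define V where "V l z = (\<chi> i k. if k = l then v $ i else A z $ i $ k)" for l z
  define q where "q l z = det (V l z) / det (A z)" for l z
  have JI: "J k \<in> multiindices n r" for k using J by auto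
  have detA: "\<bar>det (A z)\<bar> \<ge> m" if "z \<in> closed_segment x y" for z
  proof -
    have "A z = transpose (\<chi> k. iter_commutator X (J k) z)"
      by (simp add: A_def transpose_def vec_eq_iff)
    then show ?thesis using m(2)[OF that] by (simp add: det_transpose)
  qed
  have q: "(\<Sum>k\<in>UNIV. q k z *\<^sub>R iter_commutator X (J k) z) = v" if "z \<in> closed_segment x y" for z
  proof -
    have "det (A z) \<noteq> 0" using detA[OF that] m(1) by auto
    then have "A z *v (\<chi> k. q k z) = v"
      by (subst cramer) (auto simp: q_def V_def)
    then have "(\<Sum>k\<in>UNIV. A z $ i $ k * q k z) = v $ i" for i
      by (simp add: matrix_vector_mult_def vec_eq_iff)
    then show ?thesis by (simp add: vec_eq_iff A_def mult.commute)
  qed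
  have q_le: "\<bar>q l z\<bar> \<le> fact CARD('p) * E ^ CARD('p) / m" if z: "z \<in> closed_segment x y" for l z
  proof -
    have "\<bar>V l z $ i $ k\<bar> \<le> E" for i k
      using E(1) E(2)[OF JI, of z k i] component_le_norm_cart[of v i] v(2) z seg
      by (auto simp: V_def A_def)
    then have "\<bar>det (V l z)\<bar> \<le> fact CARD('p) * E ^ CARD('p)" by (rule abs_det_le)
    then show ?thesis
      using detA[OF z] m(1) E(1) unfolding q_def abs_divide by (intro frac_le) auto
  qed
  \<comment> \<open>Continuity of the Cramer coefficients along the segment provides the
    measurability of the controls.\<close>
  have contq: "continuous_on {0..1} (\<lambda>t. q l (linepath x y t))" for l
  proof -
    have c: "continuous_on {0..1} (\<lambda>t. iter_commutator X (J k) (linepath x y t) $ i)" for i k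
      by (rule continuous_on_compose2[OF cont[OF JI] continuous_on_linepath])
        (use seg linepath_in_path in blast)
    have "continuous_on {0..1} (\<lambda>t. det (A (linepath x y t)))"
      unfolding det_def A_def by (simp, intro continuous_intros c)
    moreover have cV: "continuous_on {0..1} (\<lambda>t. V l (linepath x y t) $ i $ k)" for i k
      by (cases "k = l") (auto simp: V_def A_def c)
    have "continuous_on {0..1} (\<lambda>t. det (V l (linepath x y t)))"
      unfolding det_def
      by (intro continuous_on_sum continuous_on_mult continuous_on_const continuous_on_prod cV)
    moreover have "det (A (linepath x y t)) \<noteq> 0" if "t \<in> {0..1}" for t
      using detA[OF linepath_in_path[OF that]] m(1) by auto
    ultimately show ?thesis unfolding q_def by (intro continuous_intros) auto
  qed
  \<comment> \<open>Controls are indexed by multiindices, Cramer coefficients by positions k; each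
    multiindex collects the positions where J takes it, and the empty sum gives 0 off the range of
    J.\<close>
  define a where "a I t = norm (y - x) * (\<Sum>k\<in>{k. J k = I}. q k (linepath x y t))" for I t
  have "a I \<in> borel_measurable (lebesgue_on {0..1})" for I
    unfolding a_def
    by (intro continuous_imp_measurable_on_sets_lebesgue continuous_intros contq) auto
  moreover have "\<bar>a I t\<bar> \<le> \<delta> ^ weight I" if I: "I \<in> multiindices n r" and t: "t \<in> {0..1}" for I t
  proof -
    let ?Q = "fact CARD('p) * E ^ CARD('p) / m"
    have "\<bar>\<Sum>k\<in>{k. J k = I}. q k (linepath x y t)\<bar> \<le> (\<Sum>k\<in>{k. J k = I}. ?Q)"
      by (rule order_trans[OF sum_abs sum_mono]) (rule q_le[OF linepath_in_path[OF t]])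
    \<comment> \<open>Enlarging the group to all positions is the origin of the factor
      \<open>CARD('p)\<close> in the condition on \<delta>.\<close>
    also have "\<dots> \<le> (\<Sum>k\<in>(UNIV :: 'p set). ?Q)"
      using m E by (intro sum_mono2) auto
    also have "\<dots> = CARD('p) * ?Q" by simp
    finally have "norm (y - x) * \<bar>\<Sum>k\<in>{k. J k = I}. q k (linepath x y t)\<bar>
        \<le> norm (y - x) * (CARD('p) * ?Q)" by (rule mult_left_mono) simp
    also have "\<dots> \<le> \<delta> ^ r" using \<delta>(3) by (simp add: mult_ac)
    also have "\<dots> \<le> \<delta> ^ weight I"
      using I \<delta> by (intro power_decreasing) (auto simp: multiindices_def)
    finally show ?thesis by (simp add: a_def abs_mult)
  qed
  moreover have "(linepath x y has_vector_derivative
      (\<Sum>I\<in>multiindices n r. a I t *\<^sub>R iter_commutator X I (linepath x y t))) (at t within {0..1})"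
    if t: "t \<in> {0..1}" for t
  proof -
    let ?z = "linepath x y t"
    have "(\<Sum>I\<in>multiindices n r. a I t *\<^sub>R iter_commutator X I ?z)
        = norm (y - x) *\<^sub>R (\<Sum>I\<in>multiindices n r. \<Sum>k\<in>{k\<in>UNIV. J k = I}. q k ?z *\<^sub>R iter_commutator X (J k) ?z)"
      unfolding scaleR_sum_right
      by (intro sum.cong refl) (simp add: a_def scaleR_sum_left sum_distrib_left scaleR_sum_right)
    also have "(\<Sum>I\<in>multiindices n r. \<Sum>k\<in>{k\<in>UNIV. J k = I}. q k ?z *\<^sub>R iter_commutator X (J k) ?z)
        = (\<Sum>k\<in>UNIV. q k ?z *\<^sub>R iter_commutator X (J k) ?z)"
      using J finite_multiindices by (intro sum.group) auto
    also have "\<dots> = v" by (rule q[OF linepath_in_path[OF t]])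
    also have "norm (y - x) *\<^sub>R v = y - x" by (rule v)
    finally show ?thesis using has_vector_derivative_linepath_within by metis
  qed
  moreover have "linepath x y ` {0..1} \<subseteq> \<Omega>" using seg by (simp add: linepath_image_01)
  moreover have "abs_continuous_on_interval 0 1 (linepath x y)"
  proof (rule lipschitz_imp_abs_continuous)
    show "(norm (y - x))-lipschitz_on {0..1} (linepath x y)"
    proof (rule lipschitz_onI)
      fix s t :: real
      have "linepath x y s - linepath x y t = (s - t) *\<^sub>R (y - x)"
        by (simp add: linepath_def algebra_simps)
      then show "dist (linepath x y s) (linepath x y t) \<le> norm (y - x) * dist s t"
        by (simp add: dist_norm)
    qed simp
  qed
  ultimately show ?thesis
    unfolding admissible_curves_def AE_lebesgue_on_Icc_iff
    by (intro CollectI conjI exI[of _ a] exI[of _ "{}"]) auto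
qed

section \<open>Bounds that are uniform over a class of systems\<close>

text \<open>The interface between the two kinds of data: from here on a class of systems enters the
  choice of constants only through this property, whether it comes from prescribed norms and moduli
  or from a single system.\<close>

definition commutators_equicont ::
  "(real^'p::finite) set \<Rightarrow> nat \<Rightarrow> nat \<Rightarrow> (nat \<Rightarrow> real^'p \<Rightarrow> real^'p) set \<Rightarrow> bool" where
  "commutators_equicont \<Omega> n r A \<longleftrightarrow>
     (\<forall>I\<in>multiindices n r. \<forall>k. bdd_equicont \<Omega> A (\<lambda>X x. iter_commutator X I x $ k))"

lemma commutators_equicont_bound:
  assumes "commutators_equicont \<Omega> n r A"
  obtains E where "E \<ge> 1" "\<And>X I k z. X \<in> A \<Longrightarrow> I \<in> multiindices n r \<Longrightarrow> z \<in> \<Omega> \<Longrightarrow>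
    \<bar>iter_commutator X I z $ k\<bar> \<le> E"
proof -
  have "\<exists>B. \<forall>X\<in>A. \<forall>z\<in>\<Omega>. \<bar>iter_commutator X I z $ k\<bar> \<le> B" if "I \<in> multiindices n r" for I k
    using assms that unfolding commutators_equicont_def bdd_equicont_def by blast
  then obtain B where B: "\<And>I k X z. I \<in> multiindices n r \<Longrightarrow> X \<in> A \<Longrightarrow> z \<in> \<Omega> \<Longrightarrow>
      \<bar>iter_commutator X I z $ k\<bar> \<le> B I k" by metis
  define E where "E = Max (insert 1 ((\<lambda>(I, k). B I k) ` (multiindices n r \<times> UNIV)))"
  have fin: "finite (insert 1 ((\<lambda>(I, k). B I k) ` (multiindices n r \<times> UNIV)))"
    using finite_multiindices by auto
  have "B I k \<le> E" if "I \<in> multiindices n r" for I k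
    unfolding E_def using that by (intro Max_ge[OF fin]) auto
  moreover have "E \<ge> 1" unfolding E_def by (intro Max_ge[OF fin]) auto
  ultimately show thesis using B that by (meson order_trans)
qed

lemma commutators_equicont_fields_bounded:
  fixes A :: "(nat \<Rightarrow> real^'p::finite \<Rightarrow> real^'p) set"
  assumes "commutators_equicont \<Omega> n r A"
  obtains B where "\<And>X. X \<in> A \<Longrightarrow> fields_bounded \<Omega> n r X B"
proof -
  obtain E where E: "E \<ge> 1" "\<And>X I k z. X \<in> A \<Longrightarrow> I \<in> multiindices n r \<Longrightarrow> z \<in> \<Omega> \<Longrightarrow>
    \<bar>iter_commutator X I z $ k\<bar> \<le> E" using commutators_equicont_bound[OF assms] by blast
  have "norm (iter_commutator X I x) \<le> CARD('p) * E" if "X \<in> A" "I \<in> multiindices n r" "x \<in> \<Omega>" for X I x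
  proof -
    have "norm (iter_commutator X I x) \<le> (\<Sum>k\<in>UNIV. \<bar>iter_commutator X I x $ k\<bar>)"
      by (rule norm_le_l1_cart)
    also have "\<dots> \<le> (\<Sum>k\<in>(UNIV :: 'p set). E)" using E(2) that by (intro sum_mono) auto
    finally show ?thesis by simp
  qed
  then show thesis using E(1) that[of "CARD('p) * E"] by (auto simp: fields_bounded_def)
qed

text \<open>Choose J attaining the largest minor at x; equicontinuity keeps that minor above
  \<open>c0 / 2\<close> along a short segment, so \<open>segment_admissible\<close> applies. J
  varies with x and X, but only finitely many J exist, so one radius serves all. The second bound,
  by 1, feeds the chaining argument.\<close>

lemma control_edist_local_upper_bound:
  fixes A :: "(nat \<Rightarrow> real^'p::finite \<Rightarrow> real^'p) set"
  assumes "open \<Omega>" and eq: "commutators_equicont \<Omega> n r A" and "r \<ge> 2" and c0: "c0 > 0"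
  obtains \<rho> C where "\<rho> > 0" "C > 0" "\<And>X x y. X \<in> A \<Longrightarrow> c0 \<le> max_det n r X x \<Longrightarrow>
    closed_segment x y \<subseteq> \<Omega> \<Longrightarrow> dist x y < \<rho> \<Longrightarrow>
    control_edist \<Omega> n r X x y \<le> ereal (C * norm (x - y) powr (1 / real r)) \<and>
    control_edist \<Omega> n r X x y \<le> 1"
proof -
  obtain E where E: "E \<ge> 1" "\<And>X I k z. X \<in> A \<Longrightarrow> I \<in> multiindices n r \<Longrightarrow> z \<in> \<Omega> \<Longrightarrow>
    \<bar>iter_commutator X I z $ k\<bar> \<le> E" using commutators_equicont_bound[OF eq] by blast
  let ?J = "{J :: 'p \<Rightarrow> nat list. range J \<subseteq> multiindices n r}"
  have "\<exists>\<rho>>0. \<forall>X\<in>A. \<forall>x y. closed_segment x y \<subseteq> \<Omega> \<and> dist x y < \<rho> \<longrightarrow>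
      \<bar>det (\<chi> k. iter_commutator X (J k) x) - det (\<chi> k. iter_commutator X (J k) y)\<bar> < c0 / 2"
    if J: "J \<in> ?J" for J
  proof -
    have "bdd_equicont \<Omega> A (\<lambda>X x. det (\<chi> k. iter_commutator X (J k) x))"
      using eq J by (intro bdd_equicont_det) (auto simp: commutators_equicont_def)
    then show ?thesis using c0 unfolding bdd_equicont_def by (meson half_gt_zero)
  qed
  then obtain \<rho> where \<rho>: "\<And>J. J \<in> ?J \<Longrightarrow> \<rho> J > 0"
    "\<And>J X x y. J \<in> ?J \<Longrightarrow> X \<in> A \<Longrightarrow> closed_segment x y \<subseteq> \<Omega> \<Longrightarrow> dist x y < \<rho> J \<Longrightarrow>
      \<bar>det (\<chi> k. iter_commutator X (J k) x) - det (\<chi> k. iter_commutator X (J k) y)\<bar> < c0 / 2"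
    by metis
  define K where "K = CARD('p) * (fact CARD('p) * E ^ CARD('p) / (c0 / 2))"
  have K: "K > 0" using E(1) c0 by (simp add: K_def)
  \<comment> \<open>The entry \<open>1 / K\<close> forces \<open>K * norm (y - x) \<le> 1\<close>,
    hence \<delta> \<le> 1 below.\<close>
  define \<rho>' where "\<rho>' = Min (insert (1 / K) (\<rho> ` ?J))"
  have fin: "finite (insert (1 / K) (\<rho> ` ?J))" using finite_index_tuples by auto
  have \<rho>': "\<rho>' > 0" "\<rho>' \<le> 1 / K" "\<And>J. J \<in> ?J \<Longrightarrow> \<rho>' \<le> \<rho> J"
    using fin \<rho>(1) K by (auto simp: \<rho>'_def)
  show thesis
  proof (rule that[of \<rho>' "K powr (1 / real r)"])
    fix X and x y :: "real^'p"
    assume X: "X \<in> A" and mx: "c0 \<le> max_det n r X x" and seg: "closed_segment x y \<subseteq> \<Omega>"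
      and xy: "dist x y < \<rho>'"
    show "control_edist \<Omega> n r X x y \<le> ereal (K powr (1 / real r) * norm (x - y) powr (1 / real r)) \<and>
      control_edist \<Omega> n r X x y \<le> 1"
    \<comment> \<open>For equal points the \<delta> below would be 0, while only positive \<delta>
      compete in the infimum.\<close>
    proof (cases "x = y")
      case True
      then have "control_edist \<Omega> n r X x y = 0" using seg control_edist_refl by auto
      then show ?thesis using K by (simp add: zero_ereal_def[symmetric])
    next
      case False
      \<comment> \<open>The solution of \<open>\<delta> ^ r = K * norm (y - x)\<close>, the smallest
        size that \<open>segment_admissible\<close> accepts; the exponent 1/r comes from
        here.\<close>
      define \<delta> where "\<delta> = (K * norm (y - x)) powr (1 / real r)"
      have pos: "0 < K * norm (y - x)" using False K by simp
      have \<delta>r: "\<delta> ^ r = K * norm (y - x)"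
      proof -
        have "\<delta> ^ r = \<delta> powr real r" using K False by (intro powr_realpow[symmetric]) (simp add: \<delta>_def)
        also have "\<dots> = K * norm (y - x)" using pos assms(3) by (simp add: \<delta>_def powr_powr)
        finally show ?thesis .
      qed
      have "norm (y - x) \<le> 1 / K" using xy \<rho>'(2) by (simp add: dist_norm norm_minus_commute)
      then have "K * norm (y - x) \<le> 1" using K by (simp add: field_simps)
      then have "\<delta> \<le> 1 powr (1 / real r)"
        unfolding \<delta>_def using pos by (intro powr_mono2) auto
      then have \<delta>: "0 < \<delta>" "\<delta> \<le> 1" using pos by (auto simp: \<delta>_def)
      obtain J where J: "J \<in> ?J" "max_det n r X x = \<bar>det (\<chi> k. iter_commutator X (J k) x)\<bar>"
        using max_det_attained[OF assms(3)] by (metis mem_Collect_eq)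
      have "linepath x y \<in> admissible_curves \<Omega> n r X \<delta>"
      proof (rule segment_admissible[where J = J and m = "c0 / 2" and E = E])
        fix I k assume I: "I \<in> multiindices n r"
        have "bdd_equicont \<Omega> {X} (\<lambda>X x. iter_commutator X I x $ k)"
          using eq I X by (auto simp: commutators_equicont_def intro: bdd_equicont_subset)
        then show "continuous_on \<Omega> (\<lambda>z. iter_commutator X I z $ k)"
          by (rule bdd_equicont_singleton_imp_continuous_on[OF assms(1)])
      next
        fix z assume z: "z \<in> closed_segment x y"
        then have "closed_segment x z \<subseteq> \<Omega>" using seg
          by (meson closed_segment_subset convex_closed_segment ends_in_segment(1) order_trans)
        moreover have "dist x z < \<rho> J"
          using z xy \<rho>'(3)[OF J(1)] dist_in_closed_segment[OF z] by (simp add: dist_commute)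
        ultimately have "\<bar>det (\<chi> k. iter_commutator X (J k) x) - det (\<chi> k. iter_commutator X (J k) z)\<bar> < c0 / 2"
          using \<rho>(2)[OF J(1) X] by blast
        then show "c0 / 2 \<le> \<bar>det (\<chi> k. iter_commutator X (J k) z)\<bar>"
          using mx J(2) by linarith
      next
        show "CARD('p) * (fact CARD('p) * E ^ CARD('p) / (c0 / 2)) * norm (y - x) \<le> \<delta> ^ r"
          using \<delta>r by (simp add: K_def)
      qed (use E X J seg c0 \<delta> in auto)
      then have "control_edist \<Omega> n r X x y \<le> ereal \<delta>"
        using \<delta> by (intro control_edist_leI[of _ "linepath x y"]) (auto simp: linepath_0' linepath_1')
      moreover have "\<delta> = K powr (1 / real r) * norm (x - y) powr (1 / real r)"
        using K by (simp add: \<delta>_def powr_mult norm_minus_commute)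
      ultimately show ?thesis using \<delta>(2)
        by (metis dual_order.trans ereal_less_eq(3) one_ereal_def)
    qed
  qed (use \<rho>' K in auto)
qed

text \<open>The number of steps depends on the set and on the step size only, not on \<open>d\<close>: points are
  replaced by the nearest point of a finite net, whose adjacency graph is connected.\<close>

lemma connected_bounded_chain:
  fixes S :: "'a::euclidean_space set"
  assumes S: "connected S" "bounded S" and \<rho>: "\<rho> > 0"
  shows "\<exists>N :: nat. \<forall>d :: 'a \<Rightarrow> 'a \<Rightarrow> ereal.
    (\<forall>x\<in>S. \<forall>y\<in>S. dist x y < \<rho> \<longrightarrow> d x y \<le> 1) \<and> (\<forall>x y z. d x z \<le> d x y + d y z) \<longrightarrow>
    (\<forall>x\<in>S. \<forall>y\<in>S. d x y \<le> ereal (real N))"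
proof -
  have "closure S \<subseteq> (\<Union>f\<in>S. ball f (\<rho> / 3))"
  proof
    fix x assume "x \<in> closure S"
    then obtain y where "y \<in> S" "dist y x < \<rho> / 3" 
      using \<rho> closure_approachable[THEN iffD1, rule_format, of x S "\<rho> / 3"] by auto
    then show "x \<in> (\<Union>f\<in>S. ball f (\<rho> / 3))" by auto
  qed
  then obtain F where F: "F \<subseteq> S" "finite F" "closure S \<subseteq> (\<Union>f\<in>F. ball f (\<rho> / 3))"
    using compactE_image[of "closure S" S "\<lambda>f. ball f (\<rho> / 3)"] S(2) by (auto simp: compact_closure)
  have "\<exists>f\<in>F. dist f x < \<rho> / 3" if "x \<in> S" for x
    using F(3) closure_subset that by fastforce
  then obtain c where c: "\<And>x. x \<in> S \<Longrightarrow> c x \<in> F" "\<And>x. x \<in> S \<Longrightarrow> dist (c x) x < \<rho> / 3" by metis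
  \<comment> \<open>Radius \<open>\<rho> / 3\<close> for the net and \<rho> for adjacency: points
    closer than \<open>\<rho> / 3\<close> have equal or adjacent representatives, so having
    connected representatives is an open relation.\<close>
  define E where "E = {(f, g). f \<in> F \<and> g \<in> F \<and> dist f g < \<rho>}"
  have symE: "sym E" by (auto simp: E_def sym_def dist_commute)
  have conn: "(c x, c y) \<in> E\<^sup>*" if "x \<in> S" "y \<in> S" for x y
  proof (rule connected_equivalence_relation[OF S(1) that, where R = "\<lambda>x y. (c x, c y) \<in> E\<^sup>*"])
    show "(c y, c x) \<in> E\<^sup>*" if "(c x, c y) \<in> E\<^sup>*" for x y
      using that symE by (metis sym_rtrancl symD)
    show "(c x, c z) \<in> E\<^sup>*" if "(c x, c y) \<in> E\<^sup>*" "(c y, c z) \<in> E\<^sup>*" for x y z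
      using that by (rule rtrancl_trans)
    fix a assume a: "a \<in> S"
    have "(c a, c x) \<in> E\<^sup>*" if x: "x \<in> S \<inter> ball a (\<rho> / 3)" for x
    proof -
      have "dist (c a) (c x) \<le> dist (c a) a + dist a x + dist (c x) x"
        by (metis add.commute add_left_mono dist_commute dist_triangle dist_triangle_le group_cancel.add1)
      also have "\<dots> < \<rho>" using c(2)[OF a] c(2)[of x] x by simp
      finally show ?thesis using a x c(1) by (auto simp: E_def)
    qed
    then show "\<exists>T. openin (top_of_set S) T \<and> a \<in> T \<and> (\<forall>x\<in>T. (c a, c x) \<in> E\<^sup>*)"
      using a \<rho> by (intro exI[of _ "S \<inter> ball a (\<rho> / 3)"]) auto
  qed
  have "\<exists>k. (f, g) \<in> E\<^sup>* \<longrightarrow> (f, g) \<in> E ^^ k" for f g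
    using rtrancl_imp_relpow by blast
  then obtain k where k: "\<And>f g. (f, g) \<in> E\<^sup>* \<Longrightarrow> (f, g) \<in> E ^^ k f g" by metis
  define N where "N = Max (insert 0 ((\<lambda>(f, g). k f g) ` (F \<times> F)))"
  have N: "k f g \<le> N" if "f \<in> F" "g \<in> F" for f g
    unfolding N_def using F(2) that by (intro Max_ge) auto
  show ?thesis
  \<comment> \<open>One step from x to its representative, one from the representative of y to y,
    and one for the offset in \<open>rel\<close>.\<close>
  proof (intro exI[of _ "N + 3"] allI impI ballI, elim conjE)
    fix d :: "'a \<Rightarrow> 'a \<Rightarrow> ereal" and x y
    assume near': "\<forall>x\<in>S. \<forall>y\<in>S. dist x y < \<rho> \<longrightarrow> d x y \<le> 1"
      and tri': "\<forall>x y z. d x z \<le> d x y + d y z" and xy: "x \<in> S" "y \<in> S"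
    have near: "d x y \<le> 1" if "x \<in> S" "y \<in> S" "dist x y < \<rho>" for x y using near' that by blast
    have tri: "d x z \<le> d x y + d y z" for x y z using tri' by blast
    \<comment> \<open>The offset 1 covers the empty path: of \<open>d f f\<close> only the bound 1
      is known.\<close>
    have rel: "d f g \<le> ereal (real m + 1)" if "f \<in> F" "(f, g) \<in> E ^^ m" for m f g
      using that(2)
    proof (induction m arbitrary: g)
      case 0
      then show ?case using near[of f f] that(1) F(1) \<rho> by (auto simp: one_ereal_def)
    next
      case (Suc m)
      then obtain h where h: "(f, h) \<in> E ^^ m" "(h, g) \<in> E" by auto
      then have "d h g \<le> 1" using near F(1) by (auto simp: E_def)
      then have "d f g \<le> ereal (real m + 1) + 1"
        using Suc.IH[OF h(1)] tri[of f g h] add_mono order_trans by blast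
      then show ?case by (simp add: one_ereal_def)
    qed
    have "d x (c x) \<le> 1" "d (c y) y \<le> 1"
      using near c xy F(1) \<rho> by (force simp: dist_commute)+
    moreover have "d (c x) (c y) \<le> ereal (real N + 1)"
    proof -
      have "d (c x) (c y) \<le> ereal (real (k (c x) (c y)) + 1)"
        by (rule rel) (use conn k c xy in auto)
      also have "\<dots> \<le> ereal (real N + 1)" using N[of "c x" "c y"] c xy by simp
      finally show ?thesis .
    qed
    moreover have "d x y \<le> d x (c x) + (d (c x) (c y) + d (c y) y)"
      using tri[of x y "c x"] tri[of "c x" y "c y"] by (meson add_left_mono order_trans)
    ultimately have "d x y \<le> 1 + (ereal (real N + 1) + 1)"
      by (meson add_mono order_trans)
    then show "d x y \<le> ereal (real (N + 3))" by (simp add: one_ereal_def add.commute)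
  qed
qed

text \<open>Close points are served by the local bound. For points at distance at least \<rho> a
  constant bound on d suffices, since \<open>norm (x - y) powr (1 / real r)\<close> is then bounded
  below; chaining supplies that constant for all systems of the class at once.\<close>

lemma control_edist_upper_bound:
  fixes A :: "(nat \<Rightarrow> real^'p::finite \<Rightarrow> real^'p) set"
  assumes "open \<Omega>" and "commutators_equicont \<Omega> n r A" and "r \<ge> 2"
    and \<Omega>': "compactly_inside \<Omega>' \<Omega>" and c0: "c0 > 0"
  obtains c where "c > 0" "\<And>X x y. X \<in> A \<Longrightarrow> (\<And>z. z \<in> \<Omega>' \<Longrightarrow> c0 \<le> max_det n r X z) \<Longrightarrow>
    x \<in> \<Omega>' \<Longrightarrow> y \<in> \<Omega>' \<Longrightarrow>
    control_edist \<Omega> n r X x y \<le> ereal (c * norm (x - y) powr (1 / real r))"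
proof -
  obtain \<rho>\<^sub>1 C where \<rho>\<^sub>1: "\<rho>\<^sub>1 > 0" "C > 0" and loc: "\<And>X x y. X \<in> A \<Longrightarrow> c0 \<le> max_det n r X x \<Longrightarrow>
    closed_segment x y \<subseteq> \<Omega> \<Longrightarrow> dist x y < \<rho>\<^sub>1 \<Longrightarrow>
    control_edist \<Omega> n r X x y \<le> ereal (C * norm (x - y) powr (1 / real r)) \<and>
    control_edist \<Omega> n r X x y \<le> 1"
    using control_edist_local_upper_bound[OF assms(1-3) c0] by blast
  \<comment> \<open>A neighbourhood of the compact closure that lies in \<Omega>; it contains the
    short segments issuing from points of \<Omega>', even where they leave \<Omega>'.\<close>
  obtain \<rho>\<^sub>2 where \<rho>\<^sub>2: "\<rho>\<^sub>2 > 0" "(\<Union>x\<in>closure \<Omega>'. ball x \<rho>\<^sub>2) \<subseteq> \<Omega>"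
    using compact_subset_open_imp_ball_epsilon_subset[of "closure \<Omega>'" \<Omega>] \<Omega>' assms(1)
    unfolding compactly_inside_def by metis
  define \<rho> where "\<rho> = min \<rho>\<^sub>1 \<rho>\<^sub>2"
  have \<rho>: "\<rho> > 0" using \<rho>\<^sub>1 \<rho>\<^sub>2 by (simp add: \<rho>_def)
  have seg: "closed_segment x y \<subseteq> \<Omega>" if "x \<in> \<Omega>'" "dist x y < \<rho>" for x y
  proof -
    have "closed_segment x y \<subseteq> ball x \<rho>\<^sub>2"
      by (rule closed_segment_subset) (use that \<rho>\<^sub>2 in \<open>auto simp: \<rho>_def\<close>)
    also have "\<dots> \<subseteq> \<Omega>" using \<rho>\<^sub>2(2) that(1) closure_subset by fastforce
    finally show ?thesis .
  qed
  have "connected \<Omega>'" "bounded \<Omega>'"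
    using \<Omega>' compact_imp_bounded closure_subset bounded_subset
    by (auto simp: compactly_inside_def domain_def)
  then obtain N :: nat where N: "\<forall>d :: real^'p \<Rightarrow> real^'p \<Rightarrow> ereal.
      (\<forall>x\<in>\<Omega>'. \<forall>y\<in>\<Omega>'. dist x y < \<rho> \<longrightarrow> d x y \<le> 1) \<and> (\<forall>x y z. d x z \<le> d x y + d y z) \<longrightarrow>
      (\<forall>x\<in>\<Omega>'. \<forall>y\<in>\<Omega>'. d x y \<le> ereal (real N))"
    using connected_bounded_chain[OF _ _ \<rho>] by blast
  \<comment> \<open>The second entry is chosen so that its product with
    \<open>\<rho> powr (1 / real r)\<close> is N.\<close>
  define c where "c = max C (real N / \<rho> powr (1 / real r))"
  show thesis
  proof (rule that[of c])
    show cpos: "c > 0" using \<rho>\<^sub>1 by (simp add: c_def)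
    fix X x y assume X: "X \<in> A" and det: "\<And>z. z \<in> \<Omega>' \<Longrightarrow> c0 \<le> max_det n r X z"
      and xy: "x \<in> \<Omega>'" "y \<in> \<Omega>'"
    obtain B where B: "fields_bounded \<Omega> n r X B"
      using commutators_equicont_fields_bounded[OF assms(2)] X by blast
    show "control_edist \<Omega> n r X x y \<le> ereal (c * norm (x - y) powr (1 / real r))"
    proof (cases "dist x y < \<rho>")
      case True
      then have "control_edist \<Omega> n r X x y \<le> ereal (C * norm (x - y) powr (1 / real r))"
        using loc[OF X det[OF xy(1)] seg[OF xy(1) True]] by (simp add: \<rho>_def)
      also have "\<dots> \<le> ereal (c * norm (x - y) powr (1 / real r))"
        by (simp add: c_def mult_right_mono)
      finally show ?thesis .
    next
      case False
      have near: "control_edist \<Omega> n r X x y \<le> 1" if "x \<in> \<Omega>'" "dist x y < \<rho>" for x y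
        using loc[OF X det[OF that(1)] seg[OF that]] that by (simp add: \<rho>_def)
      have "control_edist \<Omega> n r X x y \<le> ereal (real N)"
        using N[rule_format, of "control_edist \<Omega> n r X"] near control_edist_triangle[OF B] xy by blast
      also have "real N \<le> c * norm (x - y) powr (1 / real r)"
      proof -
        have "real N = real N / \<rho> powr (1 / real r) * \<rho> powr (1 / real r)" using \<rho> by simp
        also have "\<dots> \<le> c * norm (x - y) powr (1 / real r)"
          using False \<rho> cpos by (intro mult_mono powr_mono2) (auto simp: c_def dist_norm)
        finally show ?thesis .
      qed
      then have "ereal (real N) \<le> ereal (c * norm (x - y) powr (1 / real r))" by simp
      finally show ?thesis .
    qed
  qed
qed

section \<open>Positivity of the largest minor\<close>

text \<open>A basis extracted from the spanning commutators has as many elements as there are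
  coordinates; numbering it by the coordinates gives a matrix whose rows span, hence a nonzero
  minor.\<close>

lemma max_det_pos:
  fixes X :: "nat \<Rightarrow> real^'p::finite \<Rightarrow> real^'p"
  assumes "assumption_A2 \<Omega> n r X" "x \<in> \<Omega>"
  shows "max_det n r X x > 0"
proof -
  let ?V = "(\<lambda>I. iter_commutator X I x) ` multiindices n r"
  have span: "span ?V = UNIV" using assms by (auto simp: assumption_A2_def)
  obtain B where B: "B \<subseteq> ?V" "independent B" "?V \<subseteq> span B" "card B = dim ?V"
    using basis_exists[of ?V] by blast
  have spanB: "span B = UNIV"
    using span_mono[OF B(3)] span by (simp add: span_span top.extremum_unique)
  have "card B = CARD('p)"
    using B(2,4) spanB by (metis dim_span dim_UNIV DIM_cart DIM_real mult.right_neutral span)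
  moreover have "finite B" using B(2) independent_imp_finite by blast
  ultimately obtain f where f: "bij_betw f (UNIV :: 'p set) B"
    using finite_same_card_bij[of "UNIV :: 'p set" B] by auto
  have "\<exists>I\<in>multiindices n r. f k = iter_commutator X I x" for k
    using f B(1) by (auto simp: bij_betw_def)
  then obtain J where J: "\<And>k. J k \<in> multiindices n r" "\<And>k. f k = iter_commutator X (J k) x"
    by metis
  let ?M = "\<chi> k. iter_commutator X (J k) x"
  have "rows ?M = range f" by (auto simp: rows_def row_def J(2) image_def)
  then have "span (rows ?M) = UNIV" using f spanB by (simp add: bij_betw_def)
  then have "det ?M \<noteq> 0"
    by (simp add: matrix_left_invertible_span_rows[symmetric] invertible_left_inverse[symmetric] invertible_det_nz)
  then have "0 < \<bar>det ?M\<bar>" by simp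
  also have "\<dots> \<le> max_det n r X x" using J(1) by (intro max_det_ge) auto
  finally show ?thesis .
qed

text \<open>The sum of the absolute minors replaces their maximum: it is visibly continuous, so it
  attains a positive minimum on K, and the maximum is at least the average.\<close>

lemma max_det_bounded_below_on_compact:
  fixes X :: "nat \<Rightarrow> real^'p::finite \<Rightarrow> real^'p"
  assumes "open \<Omega>" "commutators_equicont \<Omega> n r {X}" "assumption_A2 \<Omega> n r X" "r \<ge> 2"
    and K: "compact K" "K \<subseteq> \<Omega>"
  obtains c where "c > 0" "\<And>x. x \<in> K \<Longrightarrow> c \<le> max_det n r X x"
proof (cases "K = {}")
  case True
  then show thesis using that[of 1] by auto
next
  case False
  let ?J = "{J :: 'p \<Rightarrow> nat list. range J \<subseteq> multiindices n r}"
  let ?g = "\<lambda>x. \<Sum>J\<in>?J. \<bar>det (\<chi> k. iter_commutator X (J k) x)\<bar>"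
  have "continuous_on \<Omega> (\<lambda>x. det (\<chi> k. iter_commutator X (J k) x))" if "J \<in> ?J" for J
  proof -
    have "bdd_equicont \<Omega> {X} (\<lambda>X x. det (\<chi> k. iter_commutator X (J k) x))"
      using assms(2) that by (intro bdd_equicont_det) (auto simp: commutators_equicont_def)
    then show ?thesis by (rule bdd_equicont_singleton_imp_continuous_on[OF assms(1)])
  qed
  then have "continuous_on K ?g"
    by (intro continuous_on_sum continuous_on_rabs continuous_on_subset[OF _ K(2)]) auto
  then obtain z where z: "z \<in> K" "\<And>x. x \<in> K \<Longrightarrow> ?g z \<le> ?g x"
    using continuous_attains_inf[OF K(1) False] by blast
  have fin: "finite ?J" by (rule finite_index_tuples)
  have "?J \<noteq> {}" by (rule index_tuples_nonempty[OF assms(4)])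
  then have N: "card ?J > 0" using fin card_gt_0_iff by blast
  obtain J where J: "J \<in> ?J" "max_det n r X z = \<bar>det (\<chi> k. iter_commutator X (J k) z)\<bar>"
    using max_det_attained[OF assms(4)] by (metis mem_Collect_eq)
  have "0 < \<bar>det (\<chi> k. iter_commutator X (J k) z)\<bar>"
    using max_det_pos[OF assms(3), of z] J(2) z(1) K(2) by auto
  also have "\<dots> \<le> ?g z"
    by (rule member_le_sum[OF J(1) _ fin]) simp
  finally have pos: "?g z > 0" .
  have "?g z / card ?J \<le> max_det n r X x" if "x \<in> K" for x
  proof -
    have "?g z \<le> ?g x" using z that by blast
    also have "\<dots> \<le> (\<Sum>J\<in>?J. max_det n r X x)" by (intro sum_mono max_det_ge) auto
    finally show ?thesis using N by (simp add: field_simps)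
  qed
  then show thesis using that[of "?g z / card ?J"] pos N by auto
qed

section \<open>Uniform control under the assumptions on the coefficients\<close>

lemma bdry_ext_inside: "x \<in> \<Omega> \<Longrightarrow> bdry_ext \<Omega> g x = g x"
  by (simp add: bdry_ext_def)

lemma Ck_closure_bounded:
  assumes "Ck_closure k \<Omega> f" "bounded \<Omega>" "length ks \<le> k"
  obtains B where "\<And>x. x \<in> closure \<Omega> \<Longrightarrow> \<bar>bdry_ext \<Omega> (partials ks f) x\<bar> \<le> B"
proof -
  have "compact (bdry_ext \<Omega> (partials ks f) ` closure \<Omega>)"
    using assms by (intro compact_continuous_image) (auto simp: Ck_closure_def compact_closure)
  then obtain B where "\<forall>y\<in>bdry_ext \<Omega> (partials ks f) ` closure \<Omega>. norm y \<le> B"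
    using compact_imp_bounded bounded_iff by metis
  then show thesis using that by auto
qed

text \<open>A real supremum says something only about sets bounded above; the continuous extension
  to the compact closure ensures this.\<close>

lemma partials_le_Ck_norm:
  assumes "Ck_closure k \<Omega> f" "bounded \<Omega>" "length ks \<le> k" "x \<in> \<Omega>"
  shows "\<bar>partials ks f x\<bar> \<le> Ck_norm k \<Omega> f"
proof -
  obtain B where B: "\<And>x. x \<in> closure \<Omega> \<Longrightarrow> \<bar>bdry_ext \<Omega> (partials ks f) x\<bar> \<le> B"
    using Ck_closure_bounded[OF assms(1-3)] by blast
  have "x \<in> closure \<Omega>" using assms(4) closure_subset by blast
  then have "\<bar>bdry_ext \<Omega> (partials ks f) x\<bar> \<le> (SUP x\<in>closure \<Omega>. \<bar>bdry_ext \<Omega> (partials ks f) x\<bar>)"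
    using B by (intro cSUP_upper) (auto simp: bdd_above_def)
  also have "\<dots> \<le> Ck_norm k \<Omega> f"
    unfolding Ck_norm_def using finite_lists_length_le[of "UNIV :: 'a set" k] assms(3)
    by (intro Max_ge) auto
  finally show ?thesis using bdry_ext_inside[OF assms(4)] by simp
qed

lemma partials_diff_le_modulus:
  assumes "Ck_closure k \<Omega> f" "bounded \<Omega>" "length ks \<le> k" "x \<in> \<Omega>" "y \<in> \<Omega>" "dist x y \<le> s"
  shows "\<bar>partials ks f x - partials ks f y\<bar> \<le> modulus \<Omega> (partials ks f) s"
proof -
  let ?g = "bdry_ext \<Omega> (partials ks f)"
  obtain B where B: "\<And>x. x \<in> closure \<Omega> \<Longrightarrow> \<bar>?g x\<bar> \<le> B"
    using Ck_closure_bounded[OF assms(1-3)] by blast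
  have cl: "x \<in> closure \<Omega>" "y \<in> closure \<Omega>" using assms closure_subset by blast+
  have "\<bar>?g x - ?g y\<bar> \<le> 2 * B" if "x \<in> closure \<Omega>" "y \<in> closure \<Omega>" for x y
    using B[OF that(1)] B[OF that(2)] by linarith
  then have "bdd_above ((\<lambda>(x, y). \<bar>?g x - ?g y\<bar>) `
      {(x, y). x \<in> closure \<Omega> \<and> y \<in> closure \<Omega> \<and> dist x y \<le> s})"
    by (auto simp: bdd_above_def)
  then have "(case (x, y) of (x, y) \<Rightarrow> \<bar>?g x - ?g y\<bar>) \<le> modulus \<Omega> (partials ks f) s"
    unfolding modulus_def using cl assms(6) by (intro cSUP_upper) auto
  then show ?thesis using bdry_ext_inside assms(4,5) by (metis case_prod_conv)
qed

text \<open>Mean value inequality on the segment; expanding a vector in the standard basis bounds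
  the operator norm of the derivative by \<open>CARD('p) * M\<close>.\<close>

lemma diff_le_of_partial_bound:
  fixes f :: "real^'p::finite \<Rightarrow> real" and M :: real
  assumes "open \<Omega>" "f differentiable_on \<Omega>" "\<And>k x. x \<in> \<Omega> \<Longrightarrow> \<bar>partial k f x\<bar> \<le> M"
    and seg: "closed_segment x y \<subseteq> \<Omega>"
  shows "\<bar>f x - f y\<bar> \<le> CARD('p) * M * norm (x - y)"
proof -
  have "norm (f x - f y) \<le> CARD('p) * M * norm (x - y)"
  proof (rule differentiable_bound[where S = "closed_segment x y"
        and f' = "\<lambda>z. frechet_derivative f (at z)"])
    fix z assume "z \<in> closed_segment x y"
    then have z: "z \<in> \<Omega>" using seg by blast
    let ?D = "frechet_derivative f (at z)"
    have D: "(f has_derivative ?D) (at z)" by (rule has_derivative_frechet[OF assms(1,2) z])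
    then show "(f has_derivative ?D) (at z within closed_segment x y)"
      by (rule has_derivative_at_withinI)
    have lin: "linear ?D" using D by (rule has_derivative_linear)
    show "onorm ?D \<le> CARD('p) * M"
    proof (rule onorm_le)
      fix h :: "real^'p"
      have "?D h = ?D (\<Sum>k\<in>UNIV. h $ k *\<^sub>R axis k 1)"
        using basis_expansion[of h] by (simp add: scalar_mult_eq_scaleR)
      also have "\<dots> = (\<Sum>k\<in>UNIV. h $ k * partial k f z)"
        using lin by (simp add: linear_sum linear_cmul partial_def)
      also have "norm \<dots> \<le> (\<Sum>k\<in>(UNIV :: 'p set). norm h * M)"
      proof (rule sum_norm_le)
        fix k
        show "norm (h $ k * partial k f z) \<le> norm h * M"
          using mult_mono[OF component_le_norm_cart[of h k] assms(3)[OF z, of k]] by (simp add: abs_mult)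
      qed
      finally show "norm (?D h) \<le> CARD('p) * M * norm h" by (simp add: mult_ac)
    qed
  qed auto
  then show ?thesis by simp
qed

text \<open>Below the top order, equicontinuity comes from the bound M on the next derivatives; at
  the top order it comes from the common modulus \<omega>.\<close>

lemma partials_family_bdd_equicont:
  fixes \<Omega> :: "(real^'p::finite) set"
  assumes "open \<Omega>" "bounded \<Omega>" "(\<omega> \<longlongrightarrow> 0) (at_right 0)"
    and A: "\<And>X. X \<in> A \<Longrightarrow> assumption_A1 \<Omega> n r X \<and> norms_bounded_by \<Omega> n r X M \<and> moduli_bounded_by \<Omega> n r X \<omega>"
    and i: "i \<le> n" and ks: "length ks \<le> r - wt i"
  shows "bdd_equicont \<Omega> A (\<lambda>X. partials ks (\<lambda>x. X i x $ k))"
proof -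
  have Ck: "Ck_closure (r - wt i) \<Omega> (\<lambda>x. X i x $ k)" if "X \<in> A" for X
    using A[OF that] i by (auto simp: assumption_A1_def)
  have bd: "\<bar>partials ls (\<lambda>x. X i x $ k) x\<bar> \<le> M" if "X \<in> A" "x \<in> \<Omega>" "length ls \<le> r - wt i" for X x ls
  proof -
    have "\<bar>partials ls (\<lambda>x. X i x $ k) x\<bar> \<le> Ck_norm (r - wt i) \<Omega> (\<lambda>x. X i x $ k)"
      by (rule partials_le_Ck_norm[OF Ck[OF that(1)] assms(2) that(3,2)])
    also have "\<dots> \<le> M" using A[OF that(1)] i by (auto simp: norms_bounded_by_def)
    finally show ?thesis .
  qed
  show ?thesis
    unfolding bdd_equicont_def
  proof (intro conjI allI impI)
    show "\<exists>B. \<forall>X\<in>A. \<forall>x\<in>\<Omega>. \<bar>partials ks (\<lambda>x. X i x $ k) x\<bar> \<le> B" using bd ks by blast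
    fix \<epsilon> :: real assume e: "\<epsilon> > 0"
    show "\<exists>\<rho>>0. \<forall>X\<in>A. \<forall>x y. closed_segment x y \<subseteq> \<Omega> \<and> dist x y < \<rho> \<longrightarrow>
        \<bar>partials ks (\<lambda>x. X i x $ k) x - partials ks (\<lambda>x. X i x $ k) y\<bar> < \<epsilon>"
    proof (cases "length ks < r - wt i")
      case True
      \<comment> \<open>The sign of M is not prescribed, hence the absolute value; the 1 makes L
        positive.\<close>
      define L where "L = CARD('p) * \<bar>M\<bar> + 1"
      have L: "L > 0" by (simp add: L_def add_nonneg_pos)
      show ?thesis
      proof (intro exI[of _ "\<epsilon> / L"] conjI ballI allI impI)
        fix X x y assume X: "X \<in> A" and xy: "closed_segment x y \<subseteq> \<Omega> \<and> dist x y < \<epsilon> / L"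
        have "\<bar>partials ks (\<lambda>x. X i x $ k) x - partials ks (\<lambda>x. X i x $ k) y\<bar> \<le> CARD('p) * \<bar>M\<bar> * norm (x - y)"
        proof (rule diff_le_of_partial_bound[OF assms(1)])
          show "partials ks (\<lambda>x. X i x $ k) differentiable_on \<Omega>"
            using Ck[OF X] True by (auto simp: Ck_closure_def)
          show "\<bar>partial l (partials ks (\<lambda>x. X i x $ k)) z\<bar> \<le> \<bar>M\<bar>" if "z \<in> \<Omega>" for l z
            using bd[OF X that, of "l # ks"] True by simp
        qed (use xy in simp)
        also have "\<dots> \<le> L * norm (x - y)" by (intro mult_right_mono) (auto simp: L_def)
        also have "\<dots> < \<epsilon>" using xy L by (simp add: dist_norm field_simps)
        finally show "\<bar>partials ks (\<lambda>x. X i x $ k) x - partials ks (\<lambda>x. X i x $ k) y\<bar> < \<epsilon>" .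
      qed (use e L in auto)
    next
      case False
      then have len: "length ks = r - wt i" using ks by simp
      have "\<forall>\<^sub>F s in at_right 0. \<omega> s < \<epsilon>" using assms(3) e by (rule order_tendstoD)
      then obtain b where b: "b > 0" "\<And>s. 0 < s \<Longrightarrow> s < b \<Longrightarrow> \<omega> s < \<epsilon>"
        unfolding eventually_at_right_field by auto
      show ?thesis
      proof (intro exI[of _ b] conjI ballI allI impI)
        fix X x y assume X: "X \<in> A" and xy: "closed_segment x y \<subseteq> \<Omega> \<and> dist x y < b"
        then have \<Omega>: "x \<in> \<Omega>" "y \<in> \<Omega>" by auto
        show "\<bar>partials ks (\<lambda>x. X i x $ k) x - partials ks (\<lambda>x. X i x $ k) y\<bar> < \<epsilon>"
        \<comment> \<open>The modulus is compared with \<omega> only at positive arguments.\<close>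
        proof (cases "x = y")
          case False
          have "\<bar>partials ks (\<lambda>x. X i x $ k) x - partials ks (\<lambda>x. X i x $ k) y\<bar>
              \<le> modulus \<Omega> (partials ks (\<lambda>x. X i x $ k)) (dist x y)"
            by (rule partials_diff_le_modulus[OF Ck[OF X] assms(2) ks \<Omega>]) simp
          also have "\<dots> \<le> \<omega> (dist x y)"
            using A[OF X] i len False by (auto simp: moduli_bounded_by_def)
          also have "\<dots> < \<epsilon>" using b(2) xy False by simp
          finally show ?thesis .
        qed (use e in simp)
      qed (use b in auto)
    qed
  qed
qed

text \<open>For one function no modulus has to be prescribed: continuity on the compact closure is
  uniform.\<close>

lemma Ck_closure_bdd_equicont:
  assumes "Ck_closure k \<Omega> f" "bounded \<Omega>" "length ks \<le> k"
  shows "bdd_equicont \<Omega> {X} (\<lambda>_. partials ks f)"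
proof -
  obtain B where B: "\<And>x. x \<in> closure \<Omega> \<Longrightarrow> \<bar>bdry_ext \<Omega> (partials ks f) x\<bar> \<le> B"
    using Ck_closure_bounded[OF assms] by blast
  have uc: "uniformly_continuous_on (closure \<Omega>) (bdry_ext \<Omega> (partials ks f))"
    using assms by (intro compact_uniformly_continuous) (auto simp: Ck_closure_def compact_closure)
  have cl: "\<And>x. x \<in> \<Omega> \<Longrightarrow> x \<in> closure \<Omega>" using closure_subset by blast
  have "\<exists>\<rho>>0. \<forall>x y. closed_segment x y \<subseteq> \<Omega> \<and> dist x y < \<rho> \<longrightarrow>
      \<bar>partials ks f x - partials ks f y\<bar> < \<epsilon>" if "\<epsilon> > 0" for \<epsilon>
  proof -
    obtain \<rho> where \<rho>: "\<rho> > 0" "\<And>x y. x \<in> closure \<Omega> \<Longrightarrow> y \<in> closure \<Omega> \<Longrightarrow> dist y x < \<rho> \<Longrightarrow>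
        dist (bdry_ext \<Omega> (partials ks f) y) (bdry_ext \<Omega> (partials ks f) x) < \<epsilon>"
      using uc \<open>\<epsilon> > 0\<close> unfolding uniformly_continuous_on_def by meson
    have "\<bar>partials ks f x - partials ks f y\<bar> < \<epsilon>" if "closed_segment x y \<subseteq> \<Omega>" "dist x y < \<rho>" for x y
    proof -
      have "x \<in> \<Omega>" "y \<in> \<Omega>" using that by auto
      then show ?thesis using \<rho>(2)[of y x] cl that(2) by (simp add: bdry_ext_inside dist_real_def)
    qed
    then show ?thesis using \<rho>(1) by blast
  qed
  moreover have "\<bar>partials ks f x\<bar> \<le> B" if "x \<in> \<Omega>" for x
    using B[OF cl[OF that]] that by (simp add: bdry_ext_inside)
  ultimately show ?thesis unfolding bdd_equicont_def by (intro conjI exI[of _ B]) auto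
qed

lemma commutators_equicontI:
  assumes "open \<Omega>" "\<And>X. X \<in> A \<Longrightarrow> assumption_A1 \<Omega> n r X"
    and "\<And>i k ks. i \<le> n \<Longrightarrow> length ks \<le> r - wt i \<Longrightarrow> bdd_equicont \<Omega> A (\<lambda>X. partials ks (\<lambda>x. X i x $ k))"
  shows "commutators_equicont \<Omega> n r A"
proof -
  have "smooth_family \<Omega> A (r - wt i) (\<lambda>X x. X i x $ k)" if "i \<le> n" for i k
    by (rule smooth_family_partials)
      (use assms(2,3) that in \<open>auto simp: assumption_A1_def Ck_closure_def\<close>)
  then show ?thesis
    unfolding commutators_equicont_def
    using smooth_family_imp_bdd_equicont[OF iter_commutator_smooth_family[OF assms(1)]] by blast
qed

lemma commutators_equicont_singleton:
  fixes \<Omega> :: "(real^'p::finite) set"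
  assumes "open \<Omega>" "bounded \<Omega>" "assumption_A1 \<Omega> n r X"
  shows "commutators_equicont \<Omega> n r {X}"
proof (rule commutators_equicontI[OF assms(1)])
  fix i k and ks :: "'p list" assume "i \<le> n" "length ks \<le> r - wt i"
  then have "bdd_equicont \<Omega> {X} (\<lambda>_. partials ks (\<lambda>x. X i x $ k))"
    using assms(3) by (intro Ck_closure_bdd_equicont[OF _ assms(2)]) (auto simp: assumption_A1_def)
  then show "bdd_equicont \<Omega> {X} (\<lambda>X. partials ks (\<lambda>x. X i x $ k))"
    unfolding bdd_equicont_def by simp
qed (use assms(3) in auto)

section \<open>Finiteness and topology of the distance\<close>

text \<open>Only x has to satisfy the determinant condition of the local bound, so the value of
  \<open>max_det\<close> at x itself, positive by (A2), can serve as \<open>c0\<close>.\<close>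

lemma control_edist_continuous:
  fixes X :: "nat \<Rightarrow> real^'p::finite \<Rightarrow> real^'p"
  assumes "open \<Omega>" "commutators_equicont \<Omega> n r {X}" "assumption_A2 \<Omega> n r X" "r \<ge> 2"
    and x: "x \<in> \<Omega>" and e: "e > 0"
  obtains \<rho> where "\<rho> > 0" "ball x \<rho> \<subseteq> \<Omega>" "\<And>y. y \<in> ball x \<rho> \<Longrightarrow> control_edist \<Omega> n r X x y < ereal e"
proof -
  obtain \<rho>\<^sub>1 C where \<rho>\<^sub>1: "\<rho>\<^sub>1 > 0" "C > 0" and loc: "\<And>Y u y. Y \<in> {X} \<Longrightarrow> max_det n r X x \<le> max_det n r Y u \<Longrightarrow>
    closed_segment u y \<subseteq> \<Omega> \<Longrightarrow> dist u y < \<rho>\<^sub>1 \<Longrightarrow>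
    control_edist \<Omega> n r Y u y \<le> ereal (C * norm (u - y) powr (1 / real r)) \<and>
    control_edist \<Omega> n r Y u y \<le> 1"
    using control_edist_local_upper_bound[OF assms(1,2,4) max_det_pos[OF assms(3) x]] by blast
  obtain \<rho>\<^sub>2 where \<rho>\<^sub>2: "\<rho>\<^sub>2 > 0" "ball x \<rho>\<^sub>2 \<subseteq> \<Omega>" using assms(1) x open_contains_ball by blast
  \<comment> \<open>The radius at which \<open>C * \<rho>\<^sub>3 powr (1 / real r)\<close> equals
    e.\<close>
  define \<rho>\<^sub>3 where "\<rho>\<^sub>3 = (e / C) powr real r"
  have \<rho>\<^sub>3: "\<rho>\<^sub>3 > 0" using e \<rho>\<^sub>1 by (simp add: \<rho>\<^sub>3_def)
  show thesis
  proof (rule that[of "min \<rho>\<^sub>1 (min \<rho>\<^sub>2 \<rho>\<^sub>3)"])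
    fix y assume y: "y \<in> ball x (min \<rho>\<^sub>1 (min \<rho>\<^sub>2 \<rho>\<^sub>3))"
    have "closed_segment x y \<subseteq> ball x \<rho>\<^sub>2"
      by (rule closed_segment_subset) (use y \<rho>\<^sub>2 in auto)
    then have "control_edist \<Omega> n r X x y \<le> ereal (C * norm (x - y) powr (1 / real r))"
      using loc[of X x y] y \<rho>\<^sub>2(2) by auto
    also have "C * norm (x - y) powr (1 / real r) < C * \<rho>\<^sub>3 powr (1 / real r)"
      using y \<rho>\<^sub>1 assms(4) by (intro mult_strict_left_mono powr_less_mono2) (auto simp: dist_norm)
    then have "ereal (C * norm (x - y) powr (1 / real r)) < ereal (C * \<rho>\<^sub>3 powr (1 / real r))" by simp
    also have "C * \<rho>\<^sub>3 powr (1 / real r) = e"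
      using e \<rho>\<^sub>1 assms(4) by (simp add: \<rho>\<^sub>3_def powr_powr)
    finally show "control_edist \<Omega> n r X x y < ereal e" .
  qed (use \<rho>\<^sub>1 \<rho>\<^sub>2 \<rho>\<^sub>3 in auto)
qed

text \<open>Finite distance is an equivalence relation on \<Omega>, and each point is at finite
  distance from a whole ball around it; a connected set admits only one class.\<close>

lemma control_edist_finite:
  assumes "domain \<Omega>" "commutators_equicont \<Omega> n r {X}" "assumption_A2 \<Omega> n r X" "r \<ge> 2"
    and xy: "x \<in> \<Omega>" "y \<in> \<Omega>"
  shows "control_edist \<Omega> n r X x y < \<infinity>"
proof -
  obtain B where B: "fields_bounded \<Omega> n r X B"
    using commutators_equicont_fields_bounded[OF assms(2)] by blast
  have \<Omega>: "open \<Omega>" "connected \<Omega>" using assms(1) by (auto simp: domain_def)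
  show ?thesis
  proof (rule connected_equivalence_relation[OF \<Omega>(2) xy, where R = "\<lambda>x y. control_edist \<Omega> n r X x y < \<infinity>"])
    show "control_edist \<Omega> n r X y x < \<infinity>" if "control_edist \<Omega> n r X x y < \<infinity>" for x y
      using that control_edist_commute[OF B] by metis
    show "control_edist \<Omega> n r X x z < \<infinity>"
      if "control_edist \<Omega> n r X x y < \<infinity>" "control_edist \<Omega> n r X y z < \<infinity>" for x y z
      using that control_edist_triangle[OF B, of x z y] by (auto simp: less_top[symmetric] top_ereal_def)
    fix a assume a: "a \<in> \<Omega>"
    obtain \<rho> where "\<rho> > 0" "ball a \<rho> \<subseteq> \<Omega>" "\<And>y. y \<in> ball a \<rho> \<Longrightarrow> control_edist \<Omega> n r X a y < ereal 1"
      using control_edist_continuous[OF \<Omega>(1) assms(2-4) a zero_less_one] by blast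
    moreover from this(3) have "control_edist \<Omega> n r X a y < \<infinity>" if "y \<in> ball a \<rho>" for y
      using that less_trans[of _ "ereal 1" \<infinity>] by (metis ereal_less_PInfty ereal_infty_less(1) PInfty_neq_ereal(1))
    ultimately show "\<exists>T. openin (top_of_set \<Omega>) T \<and> a \<in> T \<and> (\<forall>x\<in>T. control_edist \<Omega> n r X a x < \<infinity>)"
      using \<Omega>(1) by (intro exI[of _ "ball a \<rho>"]) (simp add: openin_open_eq)
  qed
qed

lemma ereal_control_dist:
  assumes "control_edist \<Omega> n r X x y < \<infinity>"
  shows "ereal (control_dist \<Omega> n r X x y) = control_edist \<Omega> n r X x y"
  using assms control_edist_nonneg[of \<Omega> n r X x y] unfolding control_dist_def
  by (intro ereal_real') auto

text \<open>The linear lower bound separates points and puts a ball of d inside each Euclidean one;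
  \<open>control_edist_continuous\<close> gives the converse inclusion. Both work near a point of
  \<Omega> without reference to any \<Omega>'.\<close>

lemma control_dist_metric:
  assumes "domain \<Omega>" "bounded \<Omega>" "r \<ge> 2" "assumption_A1 \<Omega> n r X" "assumption_A2 \<Omega> n r X"
  shows "Metric_space \<Omega> (control_dist \<Omega> n r X)"
    and "Metric_space.mtopology \<Omega> (control_dist \<Omega> n r X) = top_of_set \<Omega>"
proof -
  have \<Omega>: "open \<Omega>" using assms(1) by (simp add: domain_def)
  have eq: "commutators_equicont \<Omega> n r {X}" by (rule commutators_equicont_singleton[OF \<Omega> assms(2,4)])
  obtain B where B: "fields_bounded \<Omega> n r X B"
    using commutators_equicont_fields_bounded[OF eq] by blast
  obtain c where c: "c > 0" "\<And>X x y. fields_bounded \<Omega> n r X B \<Longrightarrow>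
    ereal (c * norm (x - y)) \<le> control_edist \<Omega> n r X x y"
    using control_edist_lower_bound[OF assms(2)] by blast
  let ?d = "control_dist \<Omega> n r X"
  have d: "ereal (?d x y) = control_edist \<Omega> n r X x y" if "x \<in> \<Omega>" "y \<in> \<Omega>" for x y
    by (rule ereal_control_dist[OF control_edist_finite[OF assms(1) eq assms(5,3) that]])
  have low: "c * norm (x - y) \<le> ?d x y" if "x \<in> \<Omega>" "y \<in> \<Omega>" for x y
    using c(2)[OF B, of x y] unfolding d[OF that, symmetric] by simp
  show metric: "Metric_space \<Omega> ?d"
  proof
    show "0 \<le> ?d x y" for x y
      using control_edist_nonneg[of \<Omega> n r X x y] by (simp add: control_dist_def real_of_ereal_pos)
    show "?d x y = ?d y x" for x y
      using control_edist_commute[OF B, of x y] by (simp add: control_dist_def)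
    show "?d x y = 0 \<longleftrightarrow> x = y" if xy: "x \<in> \<Omega>" "y \<in> \<Omega>" for x y
    proof
      assume "?d x y = 0"
      then have "c * norm (x - y) \<le> 0" using low[OF xy] by simp
      then show "x = y" using c(1) by (simp add: mult_le_0_iff)
    next
      assume "x = y"
      then show "?d x y = 0" using control_edist_refl[OF xy(1)] by (simp add: control_dist_def)
    qed
    show "?d x z \<le> ?d x y + ?d y z" if "x \<in> \<Omega>" "y \<in> \<Omega>" "z \<in> \<Omega>" for x y z
      using control_edist_triangle[OF B, of x z y] that
      by (simp add: d[symmetric])
  qed
  interpret Metric_space \<Omega> ?d by (rule metric)
  show "mtopology = top_of_set \<Omega>"
  proof (rule topology_eq[THEN iffD2, rule_format])
    fix U
    show "openin mtopology U \<longleftrightarrow> openin (top_of_set \<Omega>) U"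
      unfolding openin_mtopology openin_euclidean_subtopology_iff
    proof (intro conj_cong refl iffI ballI allI impI)
      fix x assume U: "U \<subseteq> \<Omega>" "\<forall>x. x \<in> U \<longrightarrow> (\<exists>e>0. mball x e \<subseteq> U)" and x: "x \<in> U"
      then obtain e where e: "e > 0" "mball x e \<subseteq> U" by blast
      have x\<Omega>: "x \<in> \<Omega>" using x U by blast
      obtain \<rho> where \<rho>: "\<rho> > 0" "ball x \<rho> \<subseteq> \<Omega>"
        "\<And>y. y \<in> ball x \<rho> \<Longrightarrow> control_edist \<Omega> n r X x y < ereal e"
        using control_edist_continuous[OF \<Omega> eq assms(5,3) x\<Omega> e(1)] by blast
      have "y \<in> U" if y: "y \<in> \<Omega>" "dist y x < \<rho>" for y
      proof -
        have "ereal (?d x y) < ereal e"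
          using \<rho>(3)[of y] y unfolding d[OF x\<Omega> y(1)] by (simp add: dist_commute)
        then show ?thesis using e(2) x\<Omega> y(1) by auto
      qed
      then show "\<exists>e>0. \<forall>x'\<in>\<Omega>. dist x' x < e \<longrightarrow> x' \<in> U" using \<rho>(1) by blast
    next
      fix x assume U: "U \<subseteq> \<Omega>" "\<forall>x\<in>U. \<exists>e>0. \<forall>x'\<in>\<Omega>. dist x' x < e \<longrightarrow> x' \<in> U" and x: "x \<in> U"
      then obtain e where e: "e > 0" "\<And>y. y \<in> \<Omega> \<Longrightarrow> dist y x < e \<Longrightarrow> y \<in> U" by blast
      have "mball x (c * e) \<subseteq> U"
      proof
        fix y assume "y \<in> mball x (c * e)"
        then have y: "x \<in> \<Omega>" "y \<in> \<Omega>" "?d x y < c * e" by auto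
        then have "c * norm (x - y) < c * e" using low[of x y] by linarith
        then show "y \<in> U" using e(2)[OF y(2)] c(1) by (simp add: dist_norm norm_minus_commute)
      qed
      then show "\<exists>r>0. mball x r \<subseteq> U" using e(1) c(1) by (intro exI[of _ "c * e"]) auto
    qed
  qed
qed

text \<open>The common source of both halves of the theorem, taken once with a single system and
  once with all systems sharing M and \<omega>. The quantifiers record the dependence:
  \<open>c\<^sub>1\<close> precedes \<Omega>', and \<open>c\<^sub>2\<close> follows \<Omega>' and
  \<open>c\<^sub>0\<close> but precedes the system.\<close>

lemma control_dist_bounds:
  assumes "domain \<Omega>" "bounded \<Omega>" "r \<ge> 2" and eq: "commutators_equicont \<Omega> n r A"
    and A: "\<forall>X\<in>A. assumption_A1 \<Omega> n r X \<and> assumption_A2 \<Omega> n r X"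
  shows "\<exists>c\<^sub>1>0. \<forall>\<Omega>'. compactly_inside \<Omega>' \<Omega> \<longrightarrow> (\<forall>c\<^sub>0>0. \<exists>c\<^sub>2>0. \<forall>X\<in>A. \<forall>x\<in>\<Omega>'. \<forall>y\<in>\<Omega>'.
    c\<^sub>1 * norm (x - y) \<le> control_dist \<Omega> n r X x y \<and>
    ((\<forall>z\<in>\<Omega>'. c\<^sub>0 \<le> max_det n r X z) \<longrightarrow>
      control_dist \<Omega> n r X x y \<le> c\<^sub>2 * norm (x - y) powr (1 / real r)))"
proof -
  have \<Omega>: "open \<Omega>" using assms(1) by (simp add: domain_def)
  obtain B where B: "\<And>X. X \<in> A \<Longrightarrow> fields_bounded \<Omega> n r X B"
    using commutators_equicont_fields_bounded[OF eq] by blast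
  obtain c\<^sub>1 where c1: "c\<^sub>1 > 0" "\<And>X x y. fields_bounded \<Omega> n r X B \<Longrightarrow>
    ereal (c\<^sub>1 * norm (x - y)) \<le> control_edist \<Omega> n r X x y"
    using control_edist_lower_bound[OF assms(2)] by blast
  have d: "ereal (control_dist \<Omega> n r X x y) = control_edist \<Omega> n r X x y"
    if "X \<in> A" "x \<in> \<Omega>" "y \<in> \<Omega>" for X x y
  proof (rule ereal_control_dist[OF control_edist_finite[OF assms(1)]])
    show "commutators_equicont \<Omega> n r {X}"
      using commutators_equicont_singleton[OF \<Omega> assms(2)] A that(1) by blast
  qed (use A assms that in auto)
  show ?thesis
  proof (rule exI[of _ c\<^sub>1], intro conjI allI impI c1(1))
    fix \<Omega>' and c\<^sub>0 :: real assume \<Omega>': "compactly_inside \<Omega>' \<Omega>" and c0: "c\<^sub>0 > 0"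
    have sub: "\<Omega>' \<subseteq> \<Omega>" using \<Omega>' closure_subset by (auto simp: compactly_inside_def)
    obtain c\<^sub>2 where c2: "c\<^sub>2 > 0" "\<And>X x y. X \<in> A \<Longrightarrow> (\<And>z. z \<in> \<Omega>' \<Longrightarrow> c\<^sub>0 \<le> max_det n r X z) \<Longrightarrow>
        x \<in> \<Omega>' \<Longrightarrow> y \<in> \<Omega>' \<Longrightarrow>
        control_edist \<Omega> n r X x y \<le> ereal (c\<^sub>2 * norm (x - y) powr (1 / real r))"
      using control_edist_upper_bound[OF \<Omega> eq assms(3) \<Omega>' c0] by blast
    show "\<exists>c\<^sub>2>0. \<forall>X\<in>A. \<forall>x\<in>\<Omega>'. \<forall>y\<in>\<Omega>'. c\<^sub>1 * norm (x - y) \<le> control_dist \<Omega> n r X x y \<and>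
      ((\<forall>z\<in>\<Omega>'. c\<^sub>0 \<le> max_det n r X z) \<longrightarrow>
        control_dist \<Omega> n r X x y \<le> c\<^sub>2 * norm (x - y) powr (1 / real r))"
    proof (intro exI[of _ c\<^sub>2] conjI ballI impI c2(1))
      fix X x y assume X: "X \<in> A" and xy: "x \<in> \<Omega>'" "y \<in> \<Omega>'"
      have dX: "ereal (control_dist \<Omega> n r X x y) = control_edist \<Omega> n r X x y"
        using d[OF X] xy sub by blast
      show "c\<^sub>1 * norm (x - y) \<le> control_dist \<Omega> n r X x y"
        using c1(2)[OF B[OF X], of x y] unfolding dX[symmetric] by simp
      assume "\<forall>z\<in>\<Omega>'. c\<^sub>0 \<le> max_det n r X z"
      then show "control_dist \<Omega> n r X x y \<le> c\<^sub>2 * norm (x - y) powr (1 / real r)"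
        using c2(2)[OF X _ xy] unfolding dX[symmetric] by simp
    qed
  qed
qed

theorem proposition2p3:
  fixes \<Omega> :: "(real^'p::finite) set" and n r :: nat
  assumes "domain \<Omega>" and "bounded \<Omega>" and "r \<ge> 2"
  shows
    "(\<forall>X. assumption_A1 \<Omega> n r X \<and> assumption_A2 \<Omega> n r X \<longrightarrow>
        (\<forall>x\<in>\<Omega>. \<forall>y\<in>\<Omega>. control_edist \<Omega> n r X x y < \<infinity>) \<and>
        Metric_space \<Omega> (control_dist \<Omega> n r X) \<and>
        (\<exists>c\<^sub>1>0. \<forall>\<Omega>'. compactly_inside \<Omega>' \<Omega> \<longrightarrow>
          (\<exists>c\<^sub>2>0. \<forall>x\<in>\<Omega>'. \<forall>y\<in>\<Omega>'.
             c\<^sub>1 * norm (x - y) \<le> control_dist \<Omega> n r X x y \<and>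
             control_dist \<Omega> n r X x y \<le> c\<^sub>2 * norm (x - y) powr (1 / real r))) \<and>
        Metric_space.mtopology \<Omega> (control_dist \<Omega> n r X) = top_of_set \<Omega>)
     \<and>
     (\<forall>M \<omega>. (\<omega> \<longlongrightarrow> 0) (at_right 0) \<longrightarrow>
        (\<exists>c\<^sub>1>0. \<forall>\<Omega>'. compactly_inside \<Omega>' \<Omega> \<longrightarrow>
          (\<forall>c\<^sub>0>0. \<exists>c\<^sub>2>0. \<forall>X.
             assumption_A1 \<Omega> n r X \<and> assumption_A2 \<Omega> n r X \<and>
             norms_bounded_by \<Omega> n r X M \<and> moduli_bounded_by \<Omega> n r X \<omega> \<longrightarrow>
             (\<forall>x\<in>\<Omega>'. \<forall>y\<in>\<Omega>'.
                c\<^sub>1 * norm (x - y) \<le> control_dist \<Omega> n r X x y \<and>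
                ((INF z\<in>\<Omega>'. max_det n r X z) \<ge> c\<^sub>0 \<longrightarrow>
                 control_dist \<Omega> n r X x y \<le> c\<^sub>2 * norm (x - y) powr (1 / real r))))))"
proof -
  have \<Omega>: "open \<Omega>" using assms(1) by (simp add: domain_def)
  show ?thesis
  proof (rule conjI; intro allI impI)
    fix X assume X: "assumption_A1 \<Omega> n r X \<and> assumption_A2 \<Omega> n r X"
    then have eq: "commutators_equicont \<Omega> n r {X}"
      using commutators_equicont_singleton[OF \<Omega> assms(2)] by blast
    obtain c\<^sub>1 where c1: "c\<^sub>1 > 0" "\<forall>\<Omega>'. compactly_inside \<Omega>' \<Omega> \<longrightarrow>
      (\<forall>c\<^sub>0>0. \<exists>c\<^sub>2>0. \<forall>Y\<in>{X}. \<forall>x\<in>\<Omega>'. \<forall>y\<in>\<Omega>'.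
        c\<^sub>1 * norm (x - y) \<le> control_dist \<Omega> n r Y x y \<and>
        ((\<forall>z\<in>\<Omega>'. c\<^sub>0 \<le> max_det n r Y z) \<longrightarrow>
          control_dist \<Omega> n r Y x y \<le> c\<^sub>2 * norm (x - y) powr (1 / real r)))"
      using control_dist_bounds[OF assms eq] X by blast
    have "\<exists>c\<^sub>2>0. \<forall>x\<in>\<Omega>'. \<forall>y\<in>\<Omega>'. c\<^sub>1 * norm (x - y) \<le> control_dist \<Omega> n r X x y \<and>
        control_dist \<Omega> n r X x y \<le> c\<^sub>2 * norm (x - y) powr (1 / real r)"
      if \<Omega>': "compactly_inside \<Omega>' \<Omega>" for \<Omega>'
    proof -
      \<comment> \<open>For a fixed system the lower bound on the minors is not prescribed;
        compactness of the closure produces it.\<close>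
      obtain c\<^sub>0 where c0: "c\<^sub>0 > 0" "\<And>x. x \<in> closure \<Omega>' \<Longrightarrow> c\<^sub>0 \<le> max_det n r X x"
        using max_det_bounded_below_on_compact[OF \<Omega> eq _ assms(3), of "closure \<Omega>'"] X \<Omega>'
        by (auto simp: compactly_inside_def)
      then have "\<forall>z\<in>\<Omega>'. c\<^sub>0 \<le> max_det n r X z" using closure_subset by blast
      then show ?thesis using c1(2)[rule_format, OF \<Omega>' c0(1)] by auto
    qed
    then show "(\<forall>x\<in>\<Omega>. \<forall>y\<in>\<Omega>. control_edist \<Omega> n r X x y < \<infinity>) \<and>
        Metric_space \<Omega> (control_dist \<Omega> n r X) \<and>
        (\<exists>c\<^sub>1>0. \<forall>\<Omega>'. compactly_inside \<Omega>' \<Omega> \<longrightarrow>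
          (\<exists>c\<^sub>2>0. \<forall>x\<in>\<Omega>'. \<forall>y\<in>\<Omega>'.
             c\<^sub>1 * norm (x - y) \<le> control_dist \<Omega> n r X x y \<and>
             control_dist \<Omega> n r X x y \<le> c\<^sub>2 * norm (x - y) powr (1 / real r))) \<and>
        Metric_space.mtopology \<Omega> (control_dist \<Omega> n r X) = top_of_set \<Omega>"
      using c1(1) X control_edist_finite[OF assms(1) eq _ assms(3)] control_dist_metric[OF assms]
      by (intro conjI exI[of _ c\<^sub>1]) auto
  next
    fix M :: real and \<omega> :: "real \<Rightarrow> real" assume \<omega>: "(\<omega> \<longlongrightarrow> 0) (at_right 0)"
    let ?A = "{X. assumption_A1 \<Omega> n r X \<and> assumption_A2 \<Omega> n r X \<and>
      norms_bounded_by \<Omega> n r X M \<and> moduli_bounded_by \<Omega> n r X \<omega>}"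
    have eq: "commutators_equicont \<Omega> n r ?A"
      by (rule commutators_equicontI[OF \<Omega>], simp, rule partials_family_bdd_equicont[OF \<Omega> assms(2) \<omega>]) auto
    have "\<forall>X\<in>?A. assumption_A1 \<Omega> n r X \<and> assumption_A2 \<Omega> n r X" by simp
    from control_dist_bounds[OF assms eq this]
    obtain c\<^sub>1 where c1: "c\<^sub>1 > 0" "\<forall>\<Omega>'. compactly_inside \<Omega>' \<Omega> \<longrightarrow>
      (\<forall>c\<^sub>0>0. \<exists>c\<^sub>2>0. \<forall>X\<in>?A. \<forall>x\<in>\<Omega>'. \<forall>y\<in>\<Omega>'.
        c\<^sub>1 * norm (x - y) \<le> control_dist \<Omega> n r X x y \<and>
        ((\<forall>z\<in>\<Omega>'. c\<^sub>0 \<le> max_det n r X z) \<longrightarrow>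
          control_dist \<Omega> n r X x y \<le> c\<^sub>2 * norm (x - y) powr (1 / real r)))"
      by (elim exE conjE) (rule that)
    \<comment> \<open>A real infimum bounds the values from below only if these are bounded below;
      here 0 is a lower bound, since \<open>max_det\<close> is an absolute value.\<close>
    have inf: "c\<^sub>0 \<le> max_det n r X z" if "c\<^sub>0 \<le> (INF z\<in>\<Omega>'. max_det n r X z)" "z \<in> \<Omega>'"
      for X :: "nat \<Rightarrow> real^'p \<Rightarrow> real^'p" and \<Omega>' c\<^sub>0 z
    proof -
      have "max_det n r X z \<ge> 0" for z
        using max_det_attained[OF assms(3)] by (metis abs_ge_zero)
      then have "bdd_below (max_det n r X ` \<Omega>')" by (auto simp: bdd_below_def)
      then show ?thesis using cINF_lower[of "max_det n r X" \<Omega>' z] that by linarith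
    qed
    show "\<exists>c\<^sub>1>0. \<forall>\<Omega>'. compactly_inside \<Omega>' \<Omega> \<longrightarrow>
          (\<forall>c\<^sub>0>0. \<exists>c\<^sub>2>0. \<forall>X.
             assumption_A1 \<Omega> n r X \<and> assumption_A2 \<Omega> n r X \<and>
             norms_bounded_by \<Omega> n r X M \<and> moduli_bounded_by \<Omega> n r X \<omega> \<longrightarrow>
             (\<forall>x\<in>\<Omega>'. \<forall>y\<in>\<Omega>'.
                c\<^sub>1 * norm (x - y) \<le> control_dist \<Omega> n r X x y \<and>
                ((INF z\<in>\<Omega>'. max_det n r X z) \<ge> c\<^sub>0 \<longrightarrow>
                 control_dist \<Omega> n r X x y \<le> c\<^sub>2 * norm (x - y) powr (1 / real r))))"
    proof (rule exI[of _ c\<^sub>1], intro conjI c1(1) allI impI)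
      fix \<Omega>' and c\<^sub>0 :: real assume \<Omega>': "compactly_inside \<Omega>' \<Omega>" and c0: "c\<^sub>0 > 0"
      from c1(2)[THEN spec, THEN mp, OF \<Omega>', THEN spec, THEN mp, OF c0] obtain c\<^sub>2 where c2: "c\<^sub>2 > 0" "\<forall>X\<in>?A. \<forall>x\<in>\<Omega>'. \<forall>y\<in>\<Omega>'.
        c\<^sub>1 * norm (x - y) \<le> control_dist \<Omega> n r X x y \<and>
        ((\<forall>z\<in>\<Omega>'. c\<^sub>0 \<le> max_det n r X z) \<longrightarrow>
          control_dist \<Omega> n r X x y \<le> c\<^sub>2 * norm (x - y) powr (1 / real r))"
        by (elim exE conjE) (rule that)
      show "\<exists>c\<^sub>2>0. \<forall>X.
             assumption_A1 \<Omega> n r X \<and> assumption_A2 \<Omega> n r X \<and>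
             norms_bounded_by \<Omega> n r X M \<and> moduli_bounded_by \<Omega> n r X \<omega> \<longrightarrow>
             (\<forall>x\<in>\<Omega>'. \<forall>y\<in>\<Omega>'.
                c\<^sub>1 * norm (x - y) \<le> control_dist \<Omega> n r X x y \<and>
                ((INF z\<in>\<Omega>'. max_det n r X z) \<ge> c\<^sub>0 \<longrightarrow>
                 control_dist \<Omega> n r X x y \<le> c\<^sub>2 * norm (x - y) powr (1 / real r)))"
      proof (intro exI[of _ c\<^sub>2] conjI c2(1) allI impI ballI; elim conjE)
        fix X x y
        assume "assumption_A1 \<Omega> n r X" "assumption_A2 \<Omega> n r X"
          "norms_bounded_by \<Omega> n r X M" "moduli_bounded_by \<Omega> n r X \<omega>"
        then have X: "X \<in> ?A" by simp
        assume xy: "x \<in> \<Omega>'" "y \<in> \<Omega>'"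
        note bounds = bspec[OF bspec[OF bspec[OF c2(2) X] xy(1)] xy(2)]
        show "c\<^sub>1 * norm (x - y) \<le> control_dist \<Omega> n r X x y" using bounds by blast
        assume "c\<^sub>0 \<le> (INF z\<in>\<Omega>'. max_det n r X z)"
        then have "\<forall>z\<in>\<Omega>'. c\<^sub>0 \<le> max_det n r X z" using inf by blast
        then show "control_dist \<Omega> n r X x y \<le> c\<^sub>2 * norm (x - y) powr (1 / real r)"
          using bounds by blast
      qed
    qed
  qed
qed

end
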